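(* Let $g$ belong to the Schwartz space $S(\mathbb{R})$, let $\eta\in{}^{*}\mathbb{N}\setminus\mathbb{N}$, let $g_\eta(x)={}^{*}g([\eta x]/\eta)$ on $\overline{\mathbb{R}}_\eta$, and let $\hat g_\eta(t)=\int_{\overline{\mathbb{R}}_\eta}g_\eta(x)\exp_\eta(-\pi ixt)\,d\lambda_\eta(x)$. Then $\hat g_\eta$ is $S$-integrable on $(\overline{\mathbb{R}}_\eta,\mathfrak{C}_\eta,\lambda_\eta)$, ${}^{\circ}\hat g_\eta=st^{*}(\hat g_\infty)$ almost everywhere with respect to $L(\lambda_\eta)$, and $${}^{\circ}\Big(\int_{\overline{\mathbb{R}}_\eta}\hat g_\eta\,d\lambda_\eta\Big)=\int_{\overline{\mathbb{R}}_\eta}st^{*}(\hat g_\infty)\,dL(\lambda_\eta)=\int_{\mathbb{R}}\hat g\,d\mu,$$ where $\hat g(t)=\int_{-\infty}^{\infty}g(x)e^{-\pi ixt}\,dx$.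
   Context: ${}^{*}\mathbb{R}$ is a countably saturated nonstandard extension of $\mathbb{R}$; ${}^{*}g$, ${}^{*}\exp$ are transfers, $[\cdot]$ is integer part, ${}^{\circ}$ is standard part (componentwise for complex values), $\mu$ is Lebesgue measure. $S(\mathbb{R})$ consists of smooth $g:\mathbb{R}\to\mathbb{C}$ with $\sup_x|x|^k|g^{(n)}(x)|<\infty$ for all $k,n\ge0$. $\overline{\mathbb{R}}_\eta=\{\tau\in{}^{*}\mathbb{R}:-\eta\le\tau<\eta\}$; $\mathfrak{C}_\eta$ is the internal algebra of internal unions of intervals $[k/\eta,(k+1)/\eta)$, $-\eta^2\le k<\eta^2$; $\lambda_\eta$ gives each such interval mass $1/\eta$, so $\int h\,d\lambda_\eta=\frac1\eta\sum_{k=-\eta^2}^{\eta^2-1}h(k/\eta)$; $L(\lambda_\eta)$ is the associated Loeb measure. $\exp_\eta(\pm\pi ixt)={}^{*}\exp(\pm\pi i\frac{[\eta x]}{\eta}\frac{[\eta t]}{\eta})$. An internal $\mathfrak{C}_\eta$-measurable $F$ with values in ${}^{*}\mathbb{R}$ is $S$-integrable if $\int|F|\,d\lambda_\eta$ is finite, $\int_A|F|\,d\lambda_\eta\approx0$ whenever $A\in\mathfrak{C}_\eta$ with $\lambda_\eta(A)\approx0$, and $\int_A|F|\,d\lambda_\eta\approx0$ whenever $|F|$ is infinitesimal on $A\in\mathfrak{C}_\eta$; complex-valued functions are $S$-integrable if their real and imaginary parts are. $st$ maps finite $x$ to ${}^{\circ}x$ and positive/negative infinite $x$ to $\pm\infty$;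 $\hat g_\infty$ extends $\hat g$ by $0$ at $\pm\infty$, and $st^{*}(\hat g_\infty)=\hat g_\infty\circ st$. *)

theory Defs
  imports "HOL-Analysis.Analysis"
begin

section \<open>Countably saturated nonstandard extensions\<close>

text \<open>
  A nonstandard extension is given by its transfer principle. The standard universe consists of
  the levels of the superstructure over the reals that occur in the theory of the spaces below:
  numbers, sets of reals and functions on the reals. The language has a symbol for every finitary
  relation on this universe, and an extension is an elementary extension of the universe in this
  full language. Every nonstandard extension of the whole superstructure restricts to one of this
  kind, with the same hyperreals, the same internal subsets of the hyperreals and the same internal
  functions on the hyperreals.
\<close>

datatype univ =
    Rl real
  | Cx complex
  | St "real set"
  | RFun "real \<Rightarrow> real"
  | CFun "real \<Rightarrow> complex"

datatype fm =
    Atom "univ list set" "nat list"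
  | Equal nat nat
  | Neg fm
  | And fm fm
  | Exists nat fm

primrec sat :: "(univ list set \<Rightarrow> 'h list set) \<Rightarrow> (nat \<Rightarrow> 'h) \<Rightarrow> fm \<Rightarrow> bool" where
  "sat I v (Atom R xs) \<longleftrightarrow> map v xs \<in> I R"
| "sat I v (Equal x y) \<longleftrightarrow> v x = v y"
| "sat I v (Neg p) \<longleftrightarrow> \<not> sat I v p"
| "sat I v (And p q) \<longleftrightarrow> sat I v p \<and> sat I v q"
| "sat I v (Exists x p) \<longleftrightarrow> (\<exists>a. sat I (v(x := a)) p)"

record 'h extension =
  emb :: "univ \<Rightarrow> 'h"
  star :: "univ list set \<Rightarrow> 'h list set"

definition nonstandard_extension :: "'h extension \<Rightarrow> bool" where
  "nonstandard_extension N \<longleftrightarrow>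
     (\<forall>p v. sat id v p \<longleftrightarrow> sat (star N) (emb N \<circ> v) p)"

text \<open>
  The sets \<open>{y. y # ps \<in> star N R}\<close> are internal, and every internal set of hyperreals is of this
  form, with \<open>R\<close> the membership relation and \<open>ps\<close> the set itself.
\<close>

definition countably_saturated :: "'h extension \<Rightarrow> bool" where
  "countably_saturated N \<longleftrightarrow>
     (\<forall>(R :: nat \<Rightarrow> univ list set) (ps :: nat \<Rightarrow> 'h list).
        (\<forall>n. \<exists>y. \<forall>i<n. y # ps i \<in> star N (R i)) \<longrightarrow>
        (\<exists>y. \<forall>i. y # ps i \<in> star N (R i)))"

text \<open>
  If \<open>R\<close> is the graph of a standard function \<open>f\<close>, then \<open>ap N R\<close> is the transfer of \<open>f\<close>.
\<close>

definition ap :: "'h extension \<Rightarrow> univ list set \<Rightarrow> 'h list \<Rightarrow> 'h" where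
  "ap N R xs = (THE y. xs @ [y] \<in> star N R)"

definition hypernats :: "'h extension \<Rightarrow> 'h set" where
  "hypernats N = {x. [x] \<in> star N {[Rl (real n)] | n. True}}"

definition standard_nats :: "'h extension \<Rightarrow> 'h set" where
  "standard_nats N = {emb N (Rl (real n)) | n. True}"

definition hfinite :: "'h extension \<Rightarrow> 'h \<Rightarrow> bool" where
  "hfinite N x \<longleftrightarrow> (\<exists>r. [x, emb N (Rl r)] \<in> star N {[Rl a, Rl b] | a b. \<bar>a\<bar> \<le> b})"

definition happrox :: "'h extension \<Rightarrow> 'h \<Rightarrow> 'h \<Rightarrow> bool" where
  "happrox N x y \<longleftrightarrow>
     (\<forall>e>0. [x, y, emb N (Rl e)] \<in> star N {[Rl a, Rl b, Rl c] | a b c. \<bar>a - b\<bar> < c})"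

definition infinitesimal :: "'h extension \<Rightarrow> 'h \<Rightarrow> bool" where
  "infinitesimal N x \<longleftrightarrow> happrox N x (emb N (Rl 0))"

definition std_part :: "'h extension \<Rightarrow> 'h \<Rightarrow> real" where
  "std_part N x = (THE r. happrox N x (emb N (Rl r)))"

definition st :: "'h extension \<Rightarrow> 'h \<Rightarrow> ereal" where
  "st N x = (if hfinite N x then ereal (std_part N x)
             else if [x] \<in> star N {[Rl a] | a. a > 0} then \<infinity> else - \<infinity>)"

definition hRe :: "'h extension \<Rightarrow> 'h \<Rightarrow> 'h" where
  "hRe N z = ap N {[Cx w, Rl (Re w)] | w. True} [z]"

definition hIm :: "'h extension \<Rightarrow> 'h \<Rightarrow> 'h" where
  "hIm N z = ap N {[Cx w, Rl (Im w)] | w. True} [z]"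

definition hcfinite :: "'h extension \<Rightarrow> 'h \<Rightarrow> bool" where
  "hcfinite N z \<longleftrightarrow> hfinite N (hRe N z) \<and> hfinite N (hIm N z)"

definition cstd_part :: "'h extension \<Rightarrow> 'h \<Rightarrow> complex" where
  "cstd_part N z = Complex (std_part N (hRe N z)) (std_part N (hIm N z))"

definition elems :: "'h extension \<Rightarrow> 'h \<Rightarrow> 'h set" where
  "elems N A = {x. [x, A] \<in> star N {[Rl r, St B] | r B. r \<in> B}}"

definition rval :: "'h extension \<Rightarrow> 'h \<Rightarrow> 'h \<Rightarrow> 'h" where
  "rval N F x = ap N {[RFun f, Rl r, Rl (f r)] | f r. True} [F, x]"

definition cval :: "'h extension \<Rightarrow> 'h \<Rightarrow> 'h \<Rightarrow> 'h" where
  "cval N F x = ap N {[CFun f, Rl r, Cx (f r)] | f r. True} [F, x]"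


section \<open>The measure space on the hyperfinite grid and its Loeb space\<close>

definition grid_algebra :: "nat \<Rightarrow> real set set" where
  "grid_algebra n =
     {\<Union>k\<in>K. {of_int k / real n ..< (of_int k + 1) / real n} | K. K \<subseteq> {- (int n)\<^sup>2 ..< (int n)\<^sup>2}}"

definition grid_measure :: "nat \<Rightarrow> real set \<Rightarrow> real" where
  "grid_measure n A =
     real (card {k \<in> {- (int n)\<^sup>2 ..< (int n)\<^sup>2}.
                   {of_int k / real n ..< (of_int k + 1) / real n} \<subseteq> A}) / real n"

definition grid_integral :: "nat \<Rightarrow> (real \<Rightarrow> 'a) \<Rightarrow> 'a::real_normed_field" where
  "grid_integral n h = (\<Sum>k\<in>{- (int n)\<^sup>2 ..< (int n)\<^sup>2}. h (of_int k / real n)) / of_nat n"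

definition Rbar :: "'h extension \<Rightarrow> 'h \<Rightarrow> 'h" where
  "Rbar N \<eta> = ap N {[Rl (real n), St {- real n ..< real n}] | n. True} [\<eta>]"

definition grid_sets :: "'h extension \<Rightarrow> 'h \<Rightarrow> 'h set" where
  "grid_sets N \<eta> = {A. [\<eta>, A] \<in> star N {[Rl (real n), St B] | n B. B \<in> grid_algebra n}}"

definition lam :: "'h extension \<Rightarrow> 'h \<Rightarrow> 'h \<Rightarrow> 'h" where
  "lam N \<eta> A = ap N {[Rl (real n), St B, Rl (grid_measure n B)] | n B. True} [\<eta>, A]"

definition cintegral :: "'h extension \<Rightarrow> 'h \<Rightarrow> 'h \<Rightarrow> 'h" where
  "cintegral N \<eta> F = ap N {[Rl (real n), CFun f, Cx (grid_integral n f)] | n f. True} [\<eta>, F]"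

definition abs_integral_on :: "'h extension \<Rightarrow> 'h \<Rightarrow> 'h \<Rightarrow> 'h \<Rightarrow> 'h" where
  "abs_integral_on N \<eta> A F =
     ap N {[Rl (real n), St B, RFun f, Rl (grid_integral n (\<lambda>x. indicator B x * \<bar>f x\<bar>))] | n B f. True}
       [\<eta>, A, F]"

definition grid_measurable :: "'h extension \<Rightarrow> 'h \<Rightarrow> 'h \<Rightarrow> bool" where
  "grid_measurable N \<eta> F \<longleftrightarrow>
     [\<eta>, F] \<in> star N {[Rl (real n), RFun f] | n f.
        f \<in> borel_measurable (sigma {- real n ..< real n} (grid_algebra n))}"

definition S_integrable :: "'h extension \<Rightarrow> 'h \<Rightarrow> 'h \<Rightarrow> bool" where
  "S_integrable N \<eta> F \<longleftrightarrow>
     grid_measurable N \<eta> F \<and>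
     hfinite N (abs_integral_on N \<eta> (Rbar N \<eta>) F) \<and>
     (\<forall>A\<in>grid_sets N \<eta>. infinitesimal N (lam N \<eta> A) \<longrightarrow>
        infinitesimal N (abs_integral_on N \<eta> A F)) \<and>
     (\<forall>A\<in>grid_sets N \<eta>. (\<forall>x\<in>elems N A. infinitesimal N (rval N F x)) \<longrightarrow>
        infinitesimal N (abs_integral_on N \<eta> A F))"

definition cS_integrable :: "'h extension \<Rightarrow> 'h \<Rightarrow> 'h \<Rightarrow> bool" where
  "cS_integrable N \<eta> F \<longleftrightarrow>
     S_integrable N \<eta> (ap N {[CFun f, RFun (\<lambda>x. Re (f x))] | f. True} [F]) \<and>
     S_integrable N \<eta> (ap N {[CFun f, RFun (\<lambda>x. Im (f x))] | f. True} [F])"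

text \<open>
  The Loeb measure is the completed Caratheodory extension of the standard part of the internal
  measure. An internal set is determined by its elements, so the description below is unique.
\<close>

definition loeb_content :: "'h extension \<Rightarrow> 'h \<Rightarrow> 'h set \<Rightarrow> ennreal" where
  "loeb_content N \<eta> X =
     (let m = lam N \<eta> (THE A. A \<in> grid_sets N \<eta> \<and> elems N A = X)
      in if hfinite N m then ennreal (std_part N m) else \<infinity>)"

definition loeb :: "'h extension \<Rightarrow> 'h \<Rightarrow> 'h measure" where
  "loeb N \<eta> =
     (let C = elems N ` grid_sets N \<eta>
      in completion (measure_of (elems N (Rbar N \<eta>)) C (outer_measure C (loeb_content N \<eta>))))"


section \<open>Schwartz functions and Fourier transforms\<close>

definition nth_deriv :: "nat \<Rightarrow> (real \<Rightarrow> complex) \<Rightarrow> real \<Rightarrow> complex" where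
  "nth_deriv n g = ((\<lambda>f x. vector_derivative f (at x)) ^^ n) g"

definition schwartz :: "(real \<Rightarrow> complex) \<Rightarrow> bool" where
  "schwartz g \<longleftrightarrow>
     (\<forall>n x. nth_deriv n g differentiable (at x)) \<and>
     (\<forall>k n. bdd_above (range (\<lambda>x. \<bar>x\<bar> ^ k * norm (nth_deriv n g x))))"

definition fourier :: "(real \<Rightarrow> complex) \<Rightarrow> real \<Rightarrow> complex" where
  "fourier g t = (LINT x|lebesgue. g x * exp (- (of_real pi * \<i> * of_real x * of_real t)))"

definition extend_zero :: "(real \<Rightarrow> complex) \<Rightarrow> ereal \<Rightarrow> complex" where
  "extend_zero f x = (if \<bar>x\<bar> = \<infinity> then 0 else f (real_of_ereal x))"

definition grid_point :: "nat \<Rightarrow> real \<Rightarrow> real" where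
  "grid_point n x = of_int \<lfloor>real n * x\<rfloor> / real n"

definition grid_exp :: "nat \<Rightarrow> real \<Rightarrow> real \<Rightarrow> complex" where
  "grid_exp n x t = exp (- (of_real pi * \<i> * of_real (grid_point n x) * of_real (grid_point n t)))"

definition grid_fun :: "'h extension \<Rightarrow> 'h \<Rightarrow> (real \<Rightarrow> complex) \<Rightarrow> 'h" where
  "grid_fun N \<eta> g =
     ap N {[Rl (real n), CFun f, CFun (\<lambda>x. f (grid_point n x))] | n f. True} [\<eta>, emb N (CFun g)]"

definition grid_fourier :: "'h extension \<Rightarrow> 'h \<Rightarrow> 'h \<Rightarrow> 'h" where
  "grid_fourier N \<eta> F =
     ap N {[Rl (real n), CFun f, CFun (\<lambda>t. grid_integral n (\<lambda>x. f x * grid_exp n x t))] | n f. True}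
       [\<eta>, F]"

end

theory Submission
  imports Defs "HOL-Probability.Sinc_Integral"
begin

text \<open>
  Every finite tuple of hyperobjects determines an ultrafilter, its type, and along it the
  nonstandard notions become ordinary limits: standard parts are limits, internal operations act
  pointwise. Along such an ultrafilter \<open>\<eta>\<close> is a family of natural numbers tending to infinity, so the
  theorem follows from classical estimates for the sums \<open>grid_transform g n\<close>. Summation by parts,
  applied twice, bounds them by \<open>K / (1 + t\<^sup>2)\<close> uniformly in \<open>n\<close>; the boundary terms are small since
  \<open>g\<close> decays. This gives S-integrability and the value \<open>0\<close> at infinite points. Dominated convergence
  shows that the sums converge to the Fourier transform whenever \<open>n \<rightarrow> \<infinity>\<close> and \<open>t \<rightarrow> r\<close>, and
  that their integrals converge as well. Finally the standard part map on the finite points pushes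
  the Loeb measure forward to Lebesgue measure, because the two agree on intervals.
\<close>

section \<open>Transfer\<close>

text \<open>The Loeb space involves all internal sets and points at once, while a germ presents only
  finitely many hyperobjects. No single ultrafilter is therefore fixed: each statement about a point
  or about one or two internal sets gets its own germ, and what has to agree across germs depends on
  \<eta> and standard data alone, namely \<open>ghat\<close>, \<open>Rbar\<close> and the intervals
  with standard endpoints. The one statement about infinitely many internal sets, countable
  additivity of the Loeb content, is beyond this method and rests on saturation. One summation by
  parts would give decay of order \<open>1 / t\<close> only, whose sums over the grid are not
  bounded uniformly in \<open>n\<close>; hence two. They produce chords of the unit circle instead
  of powers of \<open>t\<close>. These are comparable to \<open>t\<^sup>2\<close> because
  \<open>t\<close> stays in \<open>[-n, n)\<close>, where the phase step is at most
  \<open>pi\<close> in absolute value. Boundary values of \<open>g\<close> near both ends of the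
  grid need only be of order \<open>1 / n\<close>, the order of the summed second
  differences.\<close>

primrec exists_below :: "nat \<Rightarrow> fm \<Rightarrow> fm" where
  "exists_below 0 p = p"
| "exists_below (Suc n) p = exists_below n (Exists n p)"

lemma sat_exists_below:
  "sat I v (exists_below n p) \<longleftrightarrow> (\<exists>w. (\<forall>i\<ge>n. w i = v i) \<and> sat I w p)"
proof (induction n arbitrary: p)
  case 0
  have "w = v" if "\<forall>i. w i = v i" for w using that by auto
  then show ?case by auto
next
  case (Suc n)
  have "(\<exists>w. (\<forall>i\<ge>n. w i = v i) \<and> (\<exists>a. sat I (w(n := a)) p)) \<longleftrightarrow>
        (\<exists>w. (\<forall>i\<ge>Suc n. w i = v i) \<and> sat I w p)" (is "?L \<longleftrightarrow> ?R")
  proof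
    assume ?L
    then obtain w a where "\<forall>i\<ge>n. w i = v i" "sat I (w(n := a)) p" by auto
    then show ?R by (intro exI[of _ "w(n := a)"]) auto
  next
    assume ?R
    then obtain w where w: "\<forall>i\<ge>Suc n. w i = v i" "sat I w p" by auto
    have "\<forall>i\<ge>n. (w(n := v n)) i = v i" using w(1) by (metis Suc_leI fun_upd_apply le_neq_implies_less)
    moreover have "sat I ((w(n := v n))(n := w n)) p" using w(2) by simp
    ultimately show ?L by blast
  qed
  then show ?case using Suc by simp
qed

definition fm_iff :: "fm \<Rightarrow> fm \<Rightarrow> fm" where
  "fm_iff p q = And (Neg (And p (Neg q))) (Neg (And q (Neg p)))"

lemma sat_fm_iff [simp]: "sat I v (fm_iff p q) \<longleftrightarrow> (sat I v p \<longleftrightarrow> sat I v q)"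
  by (auto simp: fm_iff_def)

locale extension =
  fixes N :: "'h extension"
  assumes ext: "nonstandard_extension N"
begin

text \<open>The definition of an extension speaks only of assignments of embedded objects. If
  hyperobjects in the first variables refuted \<open>p\<close>, the existential closure of
  \<open>Neg p\<close> would hold in the extension at an embedded assignment, hence in the standard
  universe.\<close>

lemma transfer:
  assumes "\<And>v. sat id v p"
  shows "sat (star N) (\<lambda>i. if i < length xs then xs ! i else emb N (Rl 0)) p"
proof (rule ccontr)
  assume "\<not> ?thesis"
  then have "sat (star N) (emb N \<circ> (\<lambda>_. Rl 0)) (exists_below (length xs) (Neg p))"
    unfolding sat_exists_below
    by (intro exI[of _ "\<lambda>i. if i < length xs then xs ! i else emb N (Rl 0)"]) auto
  then have "sat id (\<lambda>_. Rl 0) (exists_below (length xs) (Neg p))"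
    using ext unfolding nonstandard_extension_def by blast
  then show False using assms unfolding sat_exists_below by simp
qed

lemma val_upt: "map (\<lambda>i. if i < length xs then xs ! i else c) [0..<length xs] = xs"
  by (rule nth_equalityI) auto

lemma star_iff:
  assumes "\<And>us. length us = length xs \<Longrightarrow> us \<in> R \<longleftrightarrow> us \<in> S"
  shows "xs \<in> star N R \<longleftrightarrow> xs \<in> star N S"
  using transfer[of "fm_iff (Atom R [0..<length xs]) (Atom S [0..<length xs])" xs] assms
  by (simp add: val_upt)

lemma star_Int: "xs \<in> star N (R \<inter> S) \<longleftrightarrow> xs \<in> star N R \<and> xs \<in> star N S"
  using transfer[of "fm_iff (Atom (R \<inter> S) [0..<length xs])
     (And (Atom R [0..<length xs]) (Atom S [0..<length xs]))" xs]
  by (simp add: val_upt)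

lemma star_Compl: "xs \<in> star N (- R) \<longleftrightarrow> xs \<notin> star N R"
  using transfer[of "fm_iff (Atom (- R) [0..<length xs]) (Neg (Atom R [0..<length xs]))" xs]
  by (simp add: val_upt)

lemma star_mono: "xs \<in> star N R \<Longrightarrow> R \<subseteq> S \<Longrightarrow> xs \<in> star N S"
  using star_Int[of xs R S] by (simp add: inf.absorb1)

lemma star_UNIV: "xs \<in> star N UNIV"
  using star_mono[of xs] star_Compl[of xs UNIV] by blast

lemma star_empty: "xs \<notin> star N {}"
  using star_Compl[of xs UNIV] star_UNIV by simp

lemma star_length: "xs \<in> star N {us. length us = length xs}"
  using star_iff[of xs "{us. length us = length xs}" UNIV] star_UNIV by simp

text \<open>Every relation has a symbol, so permuting, repeating or dropping coordinates of a
  relation leads to another symbol, and transfer compares the two.\<close>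

lemma star_reindex:
  assumes "\<And>j. j \<in> set js \<Longrightarrow> j < length xs"
  shows "map (\<lambda>j. xs ! j) js \<in> star N R \<longleftrightarrow> xs \<in> star N {us. map (\<lambda>j. us ! j) js \<in> R}"
proof -
  have "map (\<lambda>i. if i < length xs then xs ! i else emb N (Rl 0)) js = map (\<lambda>j. xs ! j) js"
    using assms by auto
  moreover have "map v js = map (\<lambda>j. map v [0..<length xs] ! j) js" for v :: "nat \<Rightarrow> univ"
    using assms by auto
  ultimately show ?thesis
    using transfer[of "fm_iff (Atom R js)
       (Atom {us. map (\<lambda>j. us ! j) js \<in> R} [0..<length xs])" xs]
    by (simp only: sat_fm_iff sat.simps val_upt mem_Collect_eq id_apply simp_thms)
qed

lemma star_take:
  "xs \<in> star N R \<longleftrightarrow> xs @ ys \<in> star N {us. take (length xs) us \<in> R}"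
proof -
  have *: "map (\<lambda>j. us ! j) [0..<length xs] = take (length xs) us"
    if "length us = length (xs @ ys)" for us :: "'b list"
    using that by (intro nth_equalityI) auto
  have "map (\<lambda>j. (xs @ ys) ! j) [0..<length xs] = xs"
    using * [of "xs @ ys"] by simp
  then have "xs \<in> star N R \<longleftrightarrow> xs @ ys \<in> star N {us. map (\<lambda>j. us ! j) [0..<length xs] \<in> R}"
    using star_reindex[of "[0..<length xs]" "xs @ ys" R] by simp
  also have "\<dots> \<longleftrightarrow> xs @ ys \<in> star N {us. take (length xs) us \<in> R}"
    by (intro star_iff) (simp add: * del: length_append upt_conv_Cons)
  finally show ?thesis .
qed

lemma star_drop:
  "ys \<in> star N R \<longleftrightarrow> xs @ ys \<in> star N {us. drop (length xs) us \<in> R}"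
proof -
  have *: "map (\<lambda>j. us ! j) [length xs..<length (xs @ ys)] = drop (length xs) us"
    if "length us = length (xs @ ys)" for us :: "'b list"
    using that by (intro nth_equalityI) auto
  have "map (\<lambda>j. (xs @ ys) ! j) [length xs..<length (xs @ ys)] = ys"
    using * [of "xs @ ys"] by simp
  then have "ys \<in> star N R \<longleftrightarrow> xs @ ys \<in> star N {us. map (\<lambda>j. us ! j) [length xs..<length (xs @ ys)] \<in> R}"
    using star_reindex[of "[length xs..<length (xs @ ys)]" "xs @ ys" R] by simp
  also have "\<dots> \<longleftrightarrow> xs @ ys \<in> star N {us. drop (length xs) us \<in> R}"
    by (intro star_iff) (simp add: * del: length_append upt_conv_Cons)
  finally show ?thesis .
qed

lemma star_project:
  assumes "j < length ys"
  shows "xs @ [ys ! j] \<in> star N R \<longleftrightarrow>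
    xs @ ys \<in> star N {us. take (length xs) us @ [us ! (length xs + j)] \<in> R}"
proof -
  have *: "map (\<lambda>j. us ! j) ([0..<length xs] @ [length xs + j]) = take (length xs) us @ [us ! (length xs + j)]"
    if "length us = length (xs @ ys)" for us :: "'b list"
    using that assms by (intro nth_equalityI) (auto simp: nth_append)
  have "map (\<lambda>j. (xs @ ys) ! j) ([0..<length xs] @ [length xs + j]) = xs @ [ys ! j]"
    using * [of "xs @ ys"] by simp
  then have "xs @ [ys ! j] \<in> star N R \<longleftrightarrow>
      xs @ ys \<in> star N {us. map (\<lambda>j. us ! j) ([0..<length xs] @ [length xs + j]) \<in> R}"
    using star_reindex[of "[0..<length xs] @ [length xs + j]" "xs @ ys" R] assms by fastforce
  also have "\<dots> \<longleftrightarrow> xs @ ys \<in> star N {us. take (length xs) us @ [us ! (length xs + j)] \<in> R}"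
    by (intro star_iff) (simp only: * mem_Collect_eq)
  finally show ?thesis .
qed

lemma star_ex: "(\<exists>y. xs @ [y] \<in> star N R) \<longleftrightarrow> xs \<in> star N {us. \<exists>u. us @ [u] \<in> R}"
proof -
  let ?n = "length xs"
  have *: "map (v(?n := a)) [0..<?n] = map v [0..<?n]" for v :: "nat \<Rightarrow> 'b" and a by auto
  show ?thesis
    using transfer[of "fm_iff (Exists ?n (Atom R [0..<Suc ?n]))
         (Atom {us. \<exists>u. us @ [u] \<in> R} [0..<?n])" xs]
    by (simp add: * val_upt)
qed

text \<open>\<open>Equal\<close> means identity of hyperobjects, so the transferred diagonal is the
  true one. Without this, transfer could not produce equations between hyperobjects.\<close>

lemma star_eq: "[x, y] \<in> star N {us. us ! 0 = us ! 1} \<longleftrightarrow> x = y"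
  using transfer[of "fm_iff (Equal 0 1) (Atom {us. us ! 0 = us ! 1} [0, 1])" "[x, y]"] by simp

lemma star_emb: "map (emb N) us \<in> star N R \<longleftrightarrow> us \<in> R"
proof -
  have "map (\<lambda>i. us ! i) [0..<length us] = us" by (rule map_nth)
  moreover have "map (emb N \<circ> (\<lambda>i. us ! i)) [0..<length us] = map (emb N) us"
    by (rule nth_equalityI) auto
  ultimately show ?thesis
    using ext[unfolded nonstandard_extension_def, rule_format,
        of "\<lambda>i. us ! i" "Atom R [0..<length us]"] by simp
qed

text \<open>For uniqueness both candidate values are put into one tuple \<open>xs @ [y, z]\<close>;
  the transferred statement about such tuples places \<open>[y, z]\<close> on the diagonal.\<close>

lemma star_functional:
  assumes xs: "xs \<in> star N {us. \<exists>!u. us @ [u] \<in> R}"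
  shows "\<exists>!y. xs @ [y] \<in> star N R"
proof (rule ex_ex1I)
  show "\<exists>y. xs @ [y] \<in> star N R"
    unfolding star_ex by (rule star_mono[OF xs]) auto
next
  fix y z assume yz: "xs @ [y] \<in> star N R" "xs @ [z] \<in> star N R"
  let ?n = "length xs"
  have "xs @ [y, z] \<in> star N {us. take ?n us @ [us ! (?n + 0)] \<in> R}"
       "xs @ [y, z] \<in> star N {us. take ?n us @ [us ! (?n + 1)] \<in> R}"
    using star_project[of 0 "[y, z]" xs R] star_project[of 1 "[y, z]" xs R] yz by auto
  moreover have "xs @ [y, z] \<in> star N {us. take ?n us \<in> {us. \<exists>!u. us @ [u] \<in> R}}"
    using xs by (subst star_take[symmetric])
  ultimately have "xs @ [y, z] \<in> star N ({us. length us = length (xs @ [y, z])} \<inter>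
      {us. take ?n us @ [us ! (?n + 0)] \<in> R} \<inter>
      {us. take ?n us @ [us ! (?n + 1)] \<in> R} \<inter> {us. take ?n us \<in> {us. \<exists>!u. us @ [u] \<in> R}})"
    using star_length[of "xs @ [y, z]"] by (simp add: star_Int)
  then have "xs @ [y, z] \<in> star N {us. drop ?n us \<in> {us. us ! 0 = us ! 1}}"
    by (rule star_mono) auto
  then have "[y, z] \<in> star N {us. us ! 0 = us ! 1}"
    by (subst star_drop)
  then show "y = z" by (simp only: star_eq)
qed

lemma ap_eqI:
  assumes "xs \<in> star N {us. \<exists>!u. us @ [u] \<in> R}" "xs @ [y] \<in> star N R"
  shows "ap N R xs = y"
  unfolding ap_def using star_functional[OF assms(1)] assms(2) by blast

lemma star_ap:
  assumes "xs \<in> star N {us. \<exists>!u. us @ [u] \<in> R}"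
  shows "xs @ [ap N R xs] \<in> star N R"
  unfolding ap_def using theI'[OF star_functional[OF assms]] .

end

text \<open>
  A germ structure presents hyperobjects as classes \<open>ev f\<close> of families of standard objects modulo an
  ultrafilter, so that \<open>los\<close> is the theorem of Los. Every finite tuple of hyperobjects lies in one:
  the ultrafilter is its type in the full language.
\<close>

locale germ = extension N for N :: "'h extension" +
  fixes T :: "'i filter" and ev :: "('i \<Rightarrow> univ) \<Rightarrow> 'h"
  assumes los: "map ev fs \<in> star N R \<longleftrightarrow> (\<forall>\<^sub>F i in T. map (\<lambda>f. f i) fs \<in> R)"
    and ev_const: "ev (\<lambda>_. u) = emb N u"
    and ultra: "\<not> eventually P T \<Longrightarrow> \<forall>\<^sub>F i in T. \<not> P i"
    and nontrivial: "T \<noteq> bot"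

text \<open>A set of indices is large when \<open>xs\<close> lies in the transfer of its image under
  \<open>e\<close>. Injectivity of \<open>e\<close> makes the index recoverable from the tuple, so a
  family indexed by \<open>'i\<close> amounts to a standard function on \<open>range e\<close>,
  which can be transferred and evaluated at \<open>xs\<close>.\<close>

lemma (in extension) germ_exists:
  fixes e :: "'i \<Rightarrow> univ list"
  assumes inj: "inj e" and xs: "xs \<in> star N (range e)"
  shows "\<exists>T ev. germ N T ev \<and> (\<forall>j<length xs. ev (\<lambda>i. e i ! j) = xs ! j)"
proof -
  define T where "T = Abs_filter (\<lambda>P. xs \<in> star N (e ` Collect P))"
  have T: "eventually P T \<longleftrightarrow> xs \<in> star N (e ` Collect P)" for P
    unfolding T_def
  proof (rule eventually_Abs_filter, unfold_locales)
    show "xs \<in> star N (e ` Collect (\<lambda>i. True))" using xs by simp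
  next
    fix P Q assume "xs \<in> star N (e ` Collect P)" "xs \<in> star N (e ` Collect Q)"
    then have "xs \<in> star N (e ` Collect P \<inter> e ` Collect Q)" by (simp add: star_Int)
    then show "xs \<in> star N (e ` Collect (\<lambda>i. P i \<and> Q i))"
      by (rule star_mono) (use inj in \<open>auto dest: injD\<close>)
  next
    fix P Q assume "\<forall>i. P i \<longrightarrow> Q i" "xs \<in> star N (e ` Collect P)"
    then show "xs \<in> star N (e ` Collect Q)" by (elim star_mono) auto
  qed
  \<comment> \<open>The graph of the function taking \<open>e i\<close> to \<open>f i\<close>;
    \<open>ev f\<close> is the value of its transfer at \<open>xs\<close>.\<close>
  define G where "G f = {e i @ [f i] |i. True}" for f
  have G_iff: "e i @ [u] \<in> G f \<longleftrightarrow> u = f i" for i u f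
    unfolding G_def using inj by (auto dest: injD)
  define ev where "ev f = ap N (G f) xs" for f
  have fun_G: "xs \<in> star N {us. \<exists>!u. us @ [u] \<in> G f}" for f
    by (rule star_mono[OF xs]) (auto simp: G_iff)
  have ev: "xs @ [ev f] \<in> star N (G f)" for f
    unfolding ev_def by (rule star_ap[OF fun_G])
  have evI: "ev f = y" if "xs @ [y] \<in> star N (G f)" for f y
    unfolding ev_def by (rule ap_eqI[OF fun_G that])
  let ?n = "length xs"
  have los: "map ev fs \<in> star N R \<longleftrightarrow> (\<forall>\<^sub>F i in T. map (\<lambda>f. f i) fs \<in> R)" for fs R
  proof -
    \<comment> \<open>Tuples made of a coded index followed by the values of all \<open>fs\<close>
      at that index. On \<open>W\<close> a relation between the values is a property of the index,
      which converts membership of the values into largeness of a set of indices.\<close>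
    define W where "W = {us. \<exists>i. length us = length (xs @ map ev fs) \<and> take ?n us = e i \<and> drop ?n us = map (\<lambda>f. f i) fs}"
    have all: "xs @ map ev fs \<in> star N {us. \<forall>j<m. take ?n us @ [us ! (?n + j)] \<in> G (fs ! j)}"
      if "m \<le> length fs" for m using that
    proof (induction m)
      case 0 then show ?case using star_UNIV by simp
    next
      case (Suc m)
      have "xs @ map ev fs \<in> star N {us. take ?n us @ [us ! (?n + m)] \<in> G (fs ! m)}"
        using star_project[of m "map ev fs" xs] Suc.prems ev[of "fs ! m"] by simp
      with Suc have "xs @ map ev fs \<in> star N ({us. \<forall>j<m. take ?n us @ [us ! (?n + j)] \<in> G (fs ! j)} \<inter>
          {us. take ?n us @ [us ! (?n + m)] \<in> G (fs ! m)})" by (simp add: star_Int)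
      then show ?case by (rule star_mono) (auto simp: less_Suc_eq)
    qed
    have "xs @ map ev fs \<in> star N ({us. length us = length (xs @ map ev fs)} \<inter>
        {us. take ?n us \<in> range e} \<inter>
        {us. \<forall>j<length fs. take ?n us @ [us ! (?n + j)] \<in> G (fs ! j)})"
      using star_length[of "xs @ map ev fs"] star_take[of xs "range e" "map ev fs"] xs all[of "length fs"]
      by (simp add: star_Int)
    then have W: "xs @ map ev fs \<in> star N W"
    proof (rule star_mono, intro subsetI)
      fix us assume us: "us \<in> {us. length us = length (xs @ map ev fs)} \<inter>
        {us. take ?n us \<in> range e} \<inter> {us. \<forall>j<length fs. take ?n us @ [us ! (?n + j)] \<in> G (fs ! j)}"
      then obtain i where i: "take ?n us = e i" by auto
      have "drop ?n us = map (\<lambda>f. f i) fs"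
        using us i by (intro nth_equalityI) (auto simp: G_iff)
      with i us show "us \<in> W" unfolding W_def by auto
    qed
    have "map ev fs \<in> star N R \<longleftrightarrow> xs @ map ev fs \<in> star N ({us. drop ?n us \<in> R} \<inter> W)"
      using W by (subst star_drop[of _ _ xs]) (simp add: star_Int)
    also have "{us. drop ?n us \<in> R} \<inter> W = {us. take ?n us \<in> e ` {i. map (\<lambda>f. f i) fs \<in> R}} \<inter> W"
      unfolding W_def using inj by (auto dest: injD)
    also have "xs @ map ev fs \<in> star N \<dots> \<longleftrightarrow> xs \<in> star N (e ` {i. map (\<lambda>f. f i) fs \<in> R})"
      using W by (subst star_take[of _ _ "map ev fs"]) (simp add: star_Int)
    finally show ?thesis unfolding T .
  qed
  have const: "ev (\<lambda>_. u) = emb N u" for u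
  proof (rule evI)
    have "[emb N u] \<in> star N {[u]}" using star_emb[of "[u]"] by simp
    then have "xs @ [emb N u] \<in> star N ({us. take ?n us \<in> range e} \<inter> {us. drop ?n us \<in> {[u]}})"
      using star_drop[of "[emb N u]" "{[u]}" xs] star_take[of xs "range e" "[emb N u]"] xs
      by (simp add: star_Int)
    then show "xs @ [emb N u] \<in> star N (G (\<lambda>_. u))"
    proof (rule star_mono, intro subsetI)
      fix us assume us: "us \<in> {us. take ?n us \<in> range e} \<inter> {us. drop ?n us \<in> {[u]}}"
      then obtain i where "take ?n us = e i" "drop ?n us = [u]" by auto
      then have "us = e i @ [u]" by (metis append_take_drop_id)
      then show "us \<in> G (\<lambda>_. u)" by (simp add: G_iff)
    qed
  qed
  have base: "ev (\<lambda>i. e i ! j) = xs ! j" if j: "j < ?n" for j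
  proof (rule evI)
    have "map ((!) xs) ([0..<?n] @ [j]) = xs @ [xs ! j]" by (simp add: map_nth)
    then have "xs @ [xs ! j] \<in> star N (G (\<lambda>i. e i ! j)) \<longleftrightarrow>
        xs \<in> star N {us. map ((!) us) ([0..<?n] @ [j]) \<in> G (\<lambda>i. e i ! j)}"
      using star_reindex[of "[0..<?n] @ [j]" xs "G (\<lambda>i. e i ! j)"] j by auto
    moreover have "xs \<in> star N (range e \<inter> {us. length us = ?n})"
      using xs star_length by (simp add: star_Int)
    then have "xs \<in> star N {us. map ((!) us) ([0..<?n] @ [j]) \<in> G (\<lambda>i. e i ! j)}"
    proof (rule star_mono, intro subsetI)
      fix us assume us: "us \<in> range e \<inter> {us. length us = ?n}"
      then obtain i where "us = e i" "length us = ?n" by auto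
      moreover have "map ((!) us) [0..<?n] = us" using us by (metis IntD2 map_nth mem_Collect_eq)
      ultimately show "us \<in> {us. map ((!) us) ([0..<?n] @ [j]) \<in> G (\<lambda>i. e i ! j)}"
        by (simp add: G_iff)
    qed
    ultimately show "xs @ [xs ! j] \<in> star N (G (\<lambda>i. e i ! j))" by simp
  qed
  have "germ N T ev"
  proof (unfold_locales)
    show "\<forall>\<^sub>F i in T. \<not> P i" if "\<not> eventually P T" for P
    proof -
      have "xs \<in> star N (- (e ` Collect P) \<inter> range e)"
        using that xs unfolding T by (simp add: star_Int star_Compl)
      then show ?thesis unfolding T by (rule star_mono) auto
    qed
    show "T \<noteq> bot"
      using T[of "\<lambda>_. False"] by (auto simp: star_empty)
  qed (fact los const)+
  with base show ?thesis by blast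
qed

section \<open>Fourier sums on the grid\<close>

lemma grid_point_bounds:
  assumes "n > 0"
  shows "grid_point n x \<le> x" "x < grid_point n x + 1 / real n"
proof -
  have "of_int \<lfloor>real n * x\<rfloor> \<le> real n * x" "real n * x < of_int \<lfloor>real n * x\<rfloor> + 1" by linarith+
  then show "grid_point n x \<le> x" "x < grid_point n x + 1 / real n"
    using assms by (auto simp: grid_point_def field_simps)
qed

lemma abs_grid_point_diff: "n > 0 \<Longrightarrow> \<bar>grid_point n x - x\<bar> \<le> 1 / real n"
  using grid_point_bounds[of n x] by linarith

lemma grid_point_of_int [simp]: "n > 0 \<Longrightarrow> grid_point n (of_int k / real n) = of_int k / real n"
  by (simp add: grid_point_def)

lemma grid_point_grid_point [simp]: "grid_point n (grid_point n x) = grid_point n x"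
  by (cases "n = 0") (simp_all add: grid_point_def)

lemma cell_iff:
  assumes "n > 0"
  shows "x \<in> {of_int k / real n ..< (of_int k + 1) / real n} \<longleftrightarrow> \<lfloor>real n * x\<rfloor> = k"
  using assms by (simp add: floor_eq_iff field_simps)

lemma floor_in_grid:
  assumes "n > 0"
  shows "\<lfloor>real n * x\<rfloor> \<in> {- (int n)\<^sup>2 ..< (int n)\<^sup>2} \<longleftrightarrow> x \<in> {- real n ..< real n}"
proof -
  have "- (int n)\<^sup>2 \<le> \<lfloor>real n * x\<rfloor> \<longleftrightarrow> real n * (- real n) \<le> real n * x"
    by (simp add: le_floor_iff power2_eq_square)
  moreover have "\<lfloor>real n * x\<rfloor> < (int n)\<^sup>2 \<longleftrightarrow> real n * x < real n * real n"
    by (simp add: floor_less_iff power2_eq_square)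
  ultimately show ?thesis using assms by (simp only: mult_le_cancel_left_pos mult_less_cancel_left_pos of_nat_0_less_iff atLeastLessThan_iff)
qed

text \<open>Viewing the grid sum as the integral of a step function makes integral comparison and
  dominated convergence available for sums over varying grids.\<close>

lemma has_bochner_integral_grid:
  fixes h :: "real \<Rightarrow> 'a::{real_normed_field, banach, second_countable_topology}"
  shows "has_bochner_integral lborel (\<lambda>x. indicator {- real n ..< real n} x *\<^sub>R h (grid_point n x))
    (grid_integral n h)"
proof (cases "n = 0")
  case True then show ?thesis by (simp add: grid_integral_def has_bochner_integral_zero)
next
  case False
  then have n: "n > 0" by simp
  let ?I = "{- (int n)\<^sup>2 ..< (int n)\<^sup>2}"
  let ?c = "\<lambda>k::int. {of_int k / real n ..< (of_int k + 1) / real n}"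
  have "has_bochner_integral lborel (\<lambda>x. indicator (?c k) x *\<^sub>R h (of_int k / real n))
     ((1 / real n) *\<^sub>R h (of_int k / real n))" for k
  proof -
    have "emeasure lborel (?c k) = ennreal (1 / real n)"
      using n by (subst emeasure_lborel_Ico) (auto simp: field_simps)
    then have "measure lborel (?c k) = 1 / real n" "emeasure lborel (?c k) < \<infinity>"
      by (simp_all add: measure_def)
    then have "has_bochner_integral lborel (indicator (?c k)) (1 / real n)"
      by (metis has_bochner_integral_real_indicator sets_lborel atLeastLessThan_borel)
    then show ?thesis by (rule has_bochner_integral_scaleR_left)
  qed
  then have "has_bochner_integral lborel (\<lambda>x. \<Sum>k\<in>?I. indicator (?c k) x *\<^sub>R h (of_int k / real n))
     (\<Sum>k\<in>?I. (1 / real n) *\<^sub>R h (of_int k / real n))"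
    by (rule has_bochner_integral_sum)
  moreover have "(\<Sum>k\<in>?I. (1 / real n) *\<^sub>R h (of_int k / real n)) = grid_integral n h"
    unfolding grid_integral_def
    by (simp add: sum_divide_distrib scaleR_conv_of_real divide_simps n)
  moreover have "(\<Sum>k\<in>?I. indicator (?c k) x *\<^sub>R h (of_int k / real n)) =
      indicator {- real n ..< real n} x *\<^sub>R h (grid_point n x)" for x
  proof -
    have "(\<Sum>k\<in>?I. indicator (?c k) x *\<^sub>R h (of_int k / real n)) =
       (\<Sum>k\<in>?I. if k = \<lfloor>real n * x\<rfloor> then h (of_int k / real n) else 0)"
      by (intro sum.cong refl) (use cell_iff[OF n, of x] in \<open>auto simp: indicator_def simp del: atLeastLessThan_iff\<close>)
    also have "\<dots> = (if \<lfloor>real n * x\<rfloor> \<in> ?I then h (grid_point n x) else 0)"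
      by (subst sum.delta) (auto simp: grid_point_def)
    finally show ?thesis using floor_in_grid[OF n, of x] by (simp add: indicator_def)
  qed
  ultimately show ?thesis by simp
qed

text \<open>The inequality \<open>x\<^sup>2 \<le> 2 * (x - y)\<^sup>2 + 2 * y\<^sup>2\<close> is
  nonnegativity of \<open>(x - 2 * y)\<^sup>2\<close>; at distance at most \<open>1\<close> it
  leaves room for the constant \<open>3\<close>.\<close>

lemma one_plus_square_le:
  fixes x y :: real
  assumes "\<bar>x - y\<bar> \<le> 1"
  shows "1 + x\<^sup>2 \<le> 3 * (1 + y\<^sup>2)"
proof -
  have "(x - y)\<^sup>2 \<le> 1" using assms abs_square_le_1 by blast
  then have "x * x - 2 * (x * y) + y * y \<le> 1" by (simp add: power2_eq_square algebra_simps)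
  moreover have "(x - 2 * y) * (x - 2 * y) \<ge> 0" by simp
  then have "x * x - 4 * (x * y) + 4 * (y * y) \<ge> 0" by (simp add: algebra_simps)
  moreover have "y * y \<ge> 0" by simp
  moreover have "a - 2 * b + c \<le> 1 \<Longrightarrow> a - 4 * b + 4 * c \<ge> 0 \<Longrightarrow> c \<ge> 0 \<Longrightarrow> 1 + a \<le> 3 * (1 + c)"
    for a b c :: real by simp
  ultimately show ?thesis unfolding power2_eq_square by blast
qed

text \<open>The factors \<open>3\<close> in the decay bounds below come from here: this is the price
  of moving a point by at most one, when rounding to the grid, when passing to an intermediate point
  of a mean value estimate, and at the ends of the grid.\<close>

lemma decay_shift:
  fixes h :: "real \<Rightarrow> 'a::real_normed_vector"
  assumes "norm (h y) \<le> C / (1 + y\<^sup>2)" "\<bar>x - y\<bar> \<le> 1"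
  shows "norm (h y) \<le> 3 * C / (1 + x\<^sup>2)"
proof -
  have pos: "0 < 1 + y\<^sup>2" "0 < 1 + x\<^sup>2" by (simp_all add: add_pos_nonneg)
  have "0 \<le> C / (1 + y\<^sup>2)" using assms(1) norm_ge_zero order_trans by blast
  then have "C \<ge> 0" using pos by (simp add: zero_le_divide_iff)
  then have "C / (1 + y\<^sup>2) \<le> 3 * C / (1 + x\<^sup>2)"
    using mult_left_mono[OF one_plus_square_le[OF assms(2)], of C] pos
    by (simp add: field_simps)
  with assms(1) show ?thesis by simp
qed

lemma decay_grid:
  fixes h :: "real \<Rightarrow> 'a::real_normed_vector"
  assumes "n > 0" "\<And>x. norm (h x) \<le> C / (1 + x\<^sup>2)"
  shows "norm (h (grid_point n x)) \<le> 3 * C / (1 + x\<^sup>2)"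
proof (rule decay_shift[OF assms(2)])
  have "1 / real n \<le> 1" using assms(1) by simp
  then show "\<bar>x - grid_point n x\<bar> \<le> 1" using abs_grid_point_diff[OF assms(1), of x] by linarith
qed

lemma tendsto_grid_point:
  assumes "filterlim m at_top F" "(t \<longlongrightarrow> r) F"
  shows "((\<lambda>i. grid_point (m i) (t i)) \<longlongrightarrow> r) F"
proof -
  have "((\<lambda>i. grid_point (m i) (t i) - t i) \<longlongrightarrow> 0) F"
  proof (rule Lim_null_comparison)
    show "((\<lambda>i. 1 / real (m i)) \<longlongrightarrow> 0) F"
      using filterlim_compose[OF lim_1_over_n assms(1)] .
    show "\<forall>\<^sub>F i in F. norm (grid_point (m i) (t i) - t i) \<le> 1 / real (m i)"
      using eventually_compose_filterlim[OF eventually_gt_at_top[of 0] assms(1)]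
      by eventually_elim (simp add: abs_grid_point_diff)
  qed
  from tendsto_add[OF this assms(2)] show ?thesis by simp
qed

lemma has_bochner_integral_decay:
  "has_bochner_integral lborel (\<lambda>x::real. C / (1 + x\<^sup>2)) (C * pi)"
proof -
  have "has_bochner_integral lborel (\<lambda>x::real. inverse (1 + x\<^sup>2)) pi"
    using integrable_inverse_1_plus_square LBINT_inverse_1_plus_square
    by (simp add: has_bochner_integral_iff set_integrable_def interval_lebesgue_integral_def
        set_lebesgue_integral_def)
  then have "has_bochner_integral lborel (\<lambda>x::real. C * inverse (1 + x\<^sup>2)) (C * pi)"
    by (rule has_bochner_integral_mult_right)
  then show ?thesis by (simp add: divide_inverse)
qed

text \<open>Rounding costs the factor \<open>3\<close>, and \<open>pi\<close> is the integral of
  \<open>1 / (1 + x\<^sup>2)\<close>. The bound is uniform in \<open>n\<close>.\<close>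

lemma grid_integral_decay:
  fixes h :: "real \<Rightarrow> 'a::{real_normed_field, banach, second_countable_topology}"
  assumes h: "\<And>x. norm (h x) \<le> C / (1 + x\<^sup>2)"
  shows "norm (grid_integral n h) \<le> 3 * C * pi"
proof (cases "n = 0")
  case True
  have "0 \<le> C" using order_trans[OF norm_ge_zero h[of 0]] by simp
  with True show ?thesis by (simp add: grid_integral_def)
next
  case False
  let ?f = "\<lambda>x. indicator {- real n ..< real n} x *\<^sub>R h (grid_point n x)"
  have bound: "norm (?f x) \<le> 3 * C / (1 + x\<^sup>2)" for x
    using decay_grid[OF _ h, of n x] False order_trans[OF norm_ge_zero]
    by (cases "x \<in> {- real n ..< real n}") (auto simp: indicator_def)
  have "norm (integral\<^sup>L lborel ?f) \<le> integral\<^sup>L lborel (\<lambda>x. 3 * C / (1 + x\<^sup>2))"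
    using has_bochner_integral_grid[of n h] has_bochner_integral_decay[of "3 * C"] bound
    by (intro Bochner_Integration.integral_norm_bound_integral) (auto simp: has_bochner_integral_iff)
  then show ?thesis
    using has_bochner_integral_grid[of n h] has_bochner_integral_decay[of "3 * C"]
    by (simp add: has_bochner_integral_iff)
qed

section \<open>Summation by parts and the chord of the unit circle\<close>

lemma sum_shift_int:
  fixes h :: "int \<Rightarrow> 'a::ab_group_add"
  assumes "a \<le> b"
  shows "(\<Sum>k\<in>{a..<b}. h (k + 1)) = (\<Sum>k\<in>{a..<b}. h k) + h b - h a"
  using assms
proof (induction b rule: int_ge_induct)
  case base then show ?case by simp
next
  case (step b)
  then have "{a..<b + 1} = insert b {a..<b}" by auto
  then show ?case using step by (simp add: algebra_simps)
qed

text \<open>The geometric sequence \<open>E\<close> is an eigenvector of the second difference with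
  eigenvalue \<open>w + inverse w - 2\<close>. Moving the second difference from \<open>f\<close> to
  \<open>E\<close> therefore reproduces the original sum times the eigenvalue, up to two boundary
  terms at each end.\<close>

lemma summation_by_parts_twice:
  fixes f E :: "int \<Rightarrow> complex"
  assumes "a \<le> b" and "w \<noteq> 0" and E: "\<And>k. E (k + 1) = E k * w"
  shows "(\<Sum>k\<in>{a..<b}. (f (k + 1) - 2 * f k + f (k - 1)) * E k) =
    (w + inverse w - 2) * (\<Sum>k\<in>{a..<b}. f k * E k)
    + (f b * E (b - 1) - f a * E (a - 1)) + (f (a - 1) * E a - f (b - 1) * E b)"
proof -
  have Em: "E (k - 1) = E k * inverse w" for k using E[of "k - 1"] \<open>w \<noteq> 0\<close> by simp
  have 1: "(\<Sum>k\<in>{a..<b}. f (k + 1) * E k) = (\<Sum>k\<in>{a..<b}. f k * E k) * inverse w + f b * E (b - 1) - f a * E (a - 1)"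
    using sum_shift_int[OF assms(1), of "\<lambda>k. f k * E (k - 1)"] by (simp add: Em mult.assoc sum_distrib_right)
  have 2: "(\<Sum>k\<in>{a..<b}. f k * E k) * w = (\<Sum>k\<in>{a..<b}. f (k - 1) * E k) + f (b - 1) * E b - f (a - 1) * E a"
    using sum_shift_int[OF assms(1), of "\<lambda>k. f (k - 1) * E k"] by (simp add: E mult.assoc sum_distrib_right)
  have 3: "(\<Sum>k\<in>{a..<b}. f (k - 1) * E k) = (\<Sum>k\<in>{a..<b}. f k * E k) * w - f (b - 1) * E b + f (a - 1) * E a"
    unfolding 2 by simp
  have "(\<Sum>k\<in>{a..<b}. (f (k + 1) - 2 * f k + f (k - 1)) * E k) =
    (\<Sum>k\<in>{a..<b}. f (k + 1) * E k) - 2 * (\<Sum>k\<in>{a..<b}. f k * E k) + (\<Sum>k\<in>{a..<b}. f (k - 1) * E k)"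
    by (simp add: algebra_simps sum.distrib sum_subtractf sum_distrib_left)
  also have "\<dots> = (w + inverse w - 2) * (\<Sum>k\<in>{a..<b}. f k * E k)
    + (f b * E (b - 1) - f a * E (a - 1)) + (f (a - 1) * E a - f (b - 1) * E b)"
    unfolding 1 3 by (simp add: algebra_simps)
  finally show ?thesis .
qed

text \<open>With \<open>y = x / 2\<close> the left side is \<open>4 * y\<^sup>2 / 9\<close> and the
  right side \<open>4 * (sin y)\<^sup>2\<close>. For \<open>\<bar>y\<bar> \<le> 2\<close> the cubic
  Taylor remainder is at most two thirds of \<open>\<bar>y\<bar>\<close>, so a third of
  \<open>\<bar>y\<bar>\<close> remains; this is the source of \<open>9\<close>.\<close>

lemma square_le_chord:
  fixes x :: real
  assumes "\<bar>x\<bar> \<le> pi"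
  shows "x\<^sup>2 / 9 \<le> 2 - 2 * cos x"
proof -
  define y where "y = x / 2"
  have y: "\<bar>y\<bar> \<le> 2" using assms pi_less_4 by (simp add: y_def)
  have "\<bar>sin y - y\<bar> \<le> inverse (fact 3) * \<bar>y\<bar> ^ 3"
    using Maclaurin_sin_bound[of y 3] by (simp add: numeral_3_eq_3 sin_coeff_def)
  also have "\<dots> = \<bar>y\<bar> * \<bar>y\<bar>\<^sup>2 / 6" by (simp add: fact_numeral power3_eq_cube power2_eq_square)
  also have "\<dots> \<le> \<bar>y\<bar> * 4 / 6"
    using y power_mono[of "\<bar>y\<bar>" 2 2] by (intro divide_right_mono mult_left_mono) auto
  finally have "\<bar>y\<bar> / 3 \<le> \<bar>sin y\<bar>" by linarith
  then have "(\<bar>y\<bar> / 3)\<^sup>2 \<le> (sin y)\<^sup>2" by (metis abs_ge_zero abs_le_square_iff abs_of_nonneg divide_nonneg_pos zero_less_numeral)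
  moreover have "cos x = 1 - 2 * (sin y)\<^sup>2" unfolding y_def using cos_double_sin[of "x / 2"] by simp
  ultimately show ?thesis by (simp add: y_def power_divide)
qed

text \<open>Decay of \<open>g\<close> controls boundary terms and dominating functions, decay of
  \<open>g2\<close> the second differences. One constant serves both bounds.\<close>

locale rapidly_decreasing =
  fixes g g1 g2 :: "real \<Rightarrow> complex" and C :: real
  assumes g1: "\<And>x. (g has_vector_derivative g1 x) (at x)"
    and g2: "\<And>x. (g1 has_vector_derivative g2 x) (at x)"
    and decay: "\<And>x. norm (g x) \<le> C / (1 + x\<^sup>2)"
    and decay2: "\<And>x. norm (g2 x) \<le> C / (1 + x\<^sup>2)"

lemma schwartz_rapidly_decreasing:
  assumes "schwartz g"
  obtains g1 g2 C where "rapidly_decreasing g g1 g2 C"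
proof -
  have diff: "nth_deriv n g differentiable (at x)" for n x
    using assms by (simp add: schwartz_def)
  have der: "(nth_deriv n g has_vector_derivative nth_deriv (Suc n) g x) (at x)" for n x
    using diff[of n x] by (simp add: nth_deriv_def vector_derivative_works)
  have bd: "\<exists>B. \<forall>x. norm (nth_deriv n g x) \<le> B / (1 + x\<^sup>2)" for n
  proof -
    have "\<exists>B. \<forall>x. \<bar>x\<bar> ^ k * norm (nth_deriv n g x) \<le> B" for k
      using assms by (auto simp: schwartz_def bdd_above_def)
    then obtain B0 B2 where B: "\<And>x. \<bar>x\<bar> ^ 0 * norm (nth_deriv n g x) \<le> B0"
      "\<And>x. \<bar>x\<bar> ^ 2 * norm (nth_deriv n g x) \<le> B2"
      by metis
    have "norm (nth_deriv n g x) \<le> (B0 + B2) / (1 + x\<^sup>2)" for x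
    proof -
      have "0 < 1 + x\<^sup>2" by (simp add: add_pos_nonneg)
      moreover have "norm (nth_deriv n g x) * (1 + x\<^sup>2) \<le> B0 + B2"
        using B(1)[of x] B(2)[of x] by (simp add: algebra_simps)
      ultimately show ?thesis by (simp add: field_simps)
    qed
    then show ?thesis by blast
  qed
  obtain B B' where B: "\<And>x. norm (nth_deriv 0 g x) \<le> B / (1 + x\<^sup>2)"
    "\<And>x. norm (nth_deriv 2 g x) \<le> B' / (1 + x\<^sup>2)"
    using bd[of 0] bd[of 2] by blast
  have "B / (1 + x\<^sup>2) \<le> max B B' / (1 + x\<^sup>2)" "B' / (1 + x\<^sup>2) \<le> max B B' / (1 + x\<^sup>2)" for x :: real
    by (intro divide_right_mono; simp)+
  then have "norm (nth_deriv 0 g x) \<le> max B B' / (1 + x\<^sup>2)"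
    "norm (nth_deriv 2 g x) \<le> max B B' / (1 + x\<^sup>2)" for x
    using B order_trans by blast+
  moreover have "nth_deriv 0 g = g" by (simp add: nth_deriv_def)
  ultimately have "rapidly_decreasing g (nth_deriv 1 g) (nth_deriv 2 g) (max B B')"
    using der[of 0] der[of 1] by unfold_locales (simp_all add: numeral_2_eq_2)
  then show ?thesis by (rule that)
qed

text \<open>The standard counterpart of \<open>ghat\<close> on the grid of size \<open>n\<close>:
  evaluated along a family of naturals representing \<eta>, it gives the internal transform.\<close>

definition grid_transform :: "(real \<Rightarrow> complex) \<Rightarrow> nat \<Rightarrow> real \<Rightarrow> complex" where
  "grid_transform g n t = grid_integral n (\<lambda>x. g (grid_point n x) * grid_exp n x t)"

lemma grid_transform_grid_point [simp]: "grid_transform g n (grid_point n t) = grid_transform g n t"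
  by (simp add: grid_transform_def grid_exp_def)

lemma norm_grid_exp [simp]: "norm (grid_exp n x t) = 1"
  by (simp add: grid_exp_def norm_exp_eq_Re)

section \<open>Uniform decay of the grid transforms\<close>

context rapidly_decreasing
begin

lemma C_nonneg: "C \<ge> 0"
  using order_trans[OF norm_ge_zero decay[of 0]] by simp

text \<open>The mean value inequality is used twice, first for the increment \<open>D\<close> on
  \<open>[x - h, x]\<close>, then for \<open>g1\<close> on an interval of length \<open>h\<close>.
  Since \<open>h \<le> 1\<close>, every point involved is within one of \<open>x\<close>, so the
  decay of \<open>g2\<close> may be read off at \<open>x\<close>.\<close>

lemma second_difference:
  assumes h: "0 < h" "h \<le> 1"
  shows "norm (g (x + h) - 2 * g x + g (x - h)) \<le> h\<^sup>2 * (3 * C / (1 + x\<^sup>2))"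
proof -
  let ?B = "3 * C / (1 + x\<^sup>2)"
  have mvt: "norm (f b - f a) \<le> B * (b - a)"
    if "\<And>y. (f has_vector_derivative f' y) (at y)" "\<And>y. y \<in> {a..b} \<Longrightarrow> norm (f' y) \<le> B" "a \<le> b"
    for f f' :: "real \<Rightarrow> complex" and a b B
  proof -
    have "norm (f b - f a) \<le> B * norm (b - a)"
    proof (rule differentiable_bound[of "{a..b}" f "\<lambda>y s. s *\<^sub>R f' y"])
      show "(f has_derivative (\<lambda>s. s *\<^sub>R f' y)) (at y within {a..b})" for y
        using that(1)[of y] by (simp add: has_vector_derivative_def has_derivative_at_withinI)
      show "onorm (\<lambda>s. s *\<^sub>R f' y) \<le> B" if "y \<in> {a..b}" for y
        using \<open>\<And>y. y \<in> {a..b} \<Longrightarrow> norm (f' y) \<le> B\<close>[OF that]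
        by (intro onorm_le) (simp add: mult.commute[of B] mult_left_mono)
    qed (use that in auto)
    then show ?thesis using that(3) by simp
  qed
  define D where "D y = g (y + h) - g y" for y
  have "norm (D x - D (x - h)) \<le> (?B * h) * (x - (x - h))"
  proof (rule mvt[where f' = "\<lambda>y. g1 (y + h) - g1 y"])
    show "(D has_vector_derivative g1 (y + h) - g1 y) (at y)" for y
    proof -
      have "((\<lambda>y. y + h) has_vector_derivative 1) (at y)"
        by (auto intro!: derivative_eq_intros)
      then have "(g \<circ> (\<lambda>y. y + h) has_vector_derivative 1 *\<^sub>R g1 (y + h)) (at y)"
        using g1[of "y + h"] by (rule vector_diff_chain_at)
      then show ?thesis
        unfolding D_def using g1[of y] by (auto simp: o_def intro!: has_vector_derivative_diff)
    qed
    show "norm (g1 (y + h) - g1 y) \<le> ?B * h" if "y \<in> {x - h..x}" for y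
    proof -
      have "norm (g1 (y + h) - g1 y) \<le> ?B * (y + h - y)"
      proof (rule mvt[OF g2])
        show "norm (g2 z) \<le> ?B" if "z \<in> {y..y + h}" for z
          using that \<open>y \<in> {x - h..x}\<close> h by (intro decay_shift[OF decay2]) auto
      qed (use h in auto)
      then show ?thesis by simp
    qed
  qed (use h in auto)
  then show ?thesis by (simp add: D_def power2_eq_square algebra_simps)
qed

text \<open>The inner factor \<open>3\<close> comes from rounding in the integrand, the outer one
  from \<open>grid_integral_decay\<close>.\<close>

lemma grid_transform_bound:
  "norm (grid_transform g n t) \<le> 3 * (3 * C) * pi"
proof (cases "n = 0")
  case True then show ?thesis using C_nonneg by (simp add: grid_transform_def grid_integral_def)
next
  case False
  then show ?thesis
    unfolding grid_transform_def by (intro grid_integral_decay) (simp add: norm_mult decay_grid decay)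
qed

lemma grid_transform_eq:
  assumes "n > 0"
  shows "grid_transform g n t = (\<Sum>k\<in>{- (int n)\<^sup>2 ..< (int n)\<^sup>2}.
     g (of_int k / real n) * cis (- (pi * grid_point n t / real n) * of_int k)) / of_nat n"
proof -
  have "grid_exp n (of_int k / real n) t = cis (- (pi * grid_point n t / real n) * of_int k)" for k
    using assms by (simp add: grid_exp_def cis_conv_exp mult_ac)
  then show ?thesis using assms by (simp add: grid_transform_def grid_integral_def)
qed

text \<open>Here \<open>\<theta>\<close> is the phase step between neighbouring grid points at
  frequency \<open>s\<close>. The chord \<open>w + inverse w - 2\<close> times the sum equals the
  sum of second differences, at most \<open>9 * C * pi / n\<close>, up to four boundary terms of at
  most \<open>3 * C / n\<close> each; the outer \<open>9\<close> comes from
  \<open>square_le_chord\<close>.\<close>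

lemma grid_transform_square_bound:
  assumes n: "n > 0" and t: "t \<in> {- real n ..< real n}"
  shows "(grid_point n t)\<^sup>2 * norm (grid_transform g n t) \<le> 9 * (9 * C * pi + 12 * C)"
proof -
  define s where "s = grid_point n t"
  define \<theta> where "\<theta> = pi * s / real n"
  define f where "f k = g (of_int k / real n)" for k :: int
  define E where "E k = cis (- \<theta> * of_int k)" for k :: int
  define w where "w = cis (- \<theta>)"
  let ?m = "(int n)\<^sup>2"
  let ?S = "\<Sum>k\<in>{- ?m ..< ?m}. f k * E k"
  have "\<lfloor>real n * t\<rfloor> \<in> {- ?m ..< ?m}" using floor_in_grid[OF n, of t] t by blast
  then have "real_of_int (- ?m) \<le> real_of_int \<lfloor>real n * t\<rfloor>" "real_of_int \<lfloor>real n * t\<rfloor> \<le> real_of_int ?m"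
    by (simp_all only: of_int_le_iff atLeastLessThan_iff less_imp_le)
  then have "\<bar>real_of_int \<lfloor>real n * t\<rfloor>\<bar> \<le> real n * real n"
    by (simp add: power2_eq_square abs_le_iff)
  then have s: "\<bar>s\<bar> \<le> real n"
    using n by (simp add: s_def grid_point_def abs_divide divide_le_eq)
  \<comment> \<open>The restriction on \<open>t\<close> enters here: the chord bounds the arc from
    below only up to half a turn.\<close>
  then have \<theta>: "\<bar>\<theta>\<bar> \<le> pi" using n by (simp add: \<theta>_def abs_mult divide_le_eq)
  have "w + inverse w - 2 = of_real (2 * cos \<theta> - 2)"
    by (simp add: w_def complex_eq_iff)
  then have "norm (w + inverse w - 2) = 2 - 2 * cos \<theta>"
    by (simp only: norm_of_real) (use cos_le_one[of \<theta>] in linarith)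
  then have w: "\<theta>\<^sup>2 / 9 \<le> norm (w + inverse w - 2)" using square_le_chord[OF \<theta>] by simp
  have normE [simp]: "norm (E k) = 1" for k by (simp add: E_def)
  have parts: "(\<Sum>k\<in>{- ?m ..< ?m}. (f (k + 1) - 2 * f k + f (k - 1)) * E k) =
    (w + inverse w - 2) * ?S + (f ?m * E (?m - 1) - f (- ?m) * E (- ?m - 1))
     + (f (- ?m - 1) * E (- ?m) - f (?m - 1) * E ?m)" (is "?D = _")
  proof (rule summation_by_parts_twice)
    show "E (k + 1) = E k * w" for k
      by (simp add: E_def w_def cis_mult algebra_simps)
  qed (auto simp: w_def)
  have "norm (f (k + 1) - 2 * f k + f (k - 1)) \<le> (1 / real n)\<^sup>2 * (3 * C / (1 + (of_int k / real n)\<^sup>2))" for k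
    using second_difference[of "1 / real n" "of_int k / real n"] n
    by (simp add: f_def add_divide_distrib diff_divide_distrib)
  then have "norm ?D \<le> (\<Sum>k\<in>{- ?m ..< ?m}. (1 / real n)\<^sup>2 * (3 * C / (1 + (of_int k / real n)\<^sup>2)))"
    by (intro sum_norm_le) (simp add: norm_mult)
  \<comment> \<open>Of the two factors \<open>1 / n\<close> of the squared step size one is the mesh
    of the grid integral; the other survives.\<close>
  also have "\<dots> = 1 / real n * grid_integral n (\<lambda>x. 3 * C / (1 + x\<^sup>2))"
  proof -
    have "(1 / real n)\<^sup>2 * A = 1 / real n * (A / of_nat n)" for A by (simp add: power2_eq_square)
    then show ?thesis unfolding grid_integral_def sum_divide_distrib sum_distrib_left by (simp only:)
  qed
  also have "\<dots> \<le> 1 / real n * (9 * C * pi)"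
  proof (intro mult_left_mono)
    have "norm (grid_integral n (\<lambda>x. 3 * C / (1 + x\<^sup>2))) \<le> 3 * (3 * C) * pi"
      using C_nonneg by (intro grid_integral_decay) (auto simp: add_nonneg_nonneg)
    then show "grid_integral n (\<lambda>x. 3 * C / (1 + x\<^sup>2)) \<le> 9 * C * pi" by simp
  qed simp
  finally have D: "norm ?D \<le> (9 * C * pi) / real n" by simp
  \<comment> \<open>Needed at \<open>n\<close>, \<open>-n\<close>, \<open>n - 1 / n\<close> and
    \<open>-n - 1 / n\<close>; comparing \<open>\<bar>y\<bar>\<close> with \<open>n\<close> treats
    both ends at once.\<close>
  have edge: "norm (g y) \<le> 3 * C / real n" if "\<bar>real n - \<bar>y\<bar>\<bar> \<le> 1" for y
  proof -
    have "norm (g y) \<le> C / (1 + \<bar>y\<bar>\<^sup>2)" using decay[of y] by simp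
    then have "norm (g y) \<le> 3 * C / (1 + (real n)\<^sup>2)"
      using decay_shift[where h = "\<lambda>_. g y" and y = "\<bar>y\<bar>" and x = "real n"] that by simp
    also have "\<dots> \<le> 3 * C / real n"
    proof (rule divide_left_mono)
      show "real n \<le> 1 + (real n)\<^sup>2" using n by (simp add: power2_eq_square add_increasing)
    qed (use C_nonneg n in \<open>auto simp: add_pos_nonneg\<close>)
    finally show ?thesis .
  qed
  have m: "real_of_int ?m / real n = real n" using n by (simp add: power2_eq_square)
  have n1: "0 < 1 / real n" "1 / real n \<le> 1" "1 \<le> real n" using n by auto
  have pts: "f ?m = g (real n)" "f (- ?m) = g (- real n)"
      "f (- ?m - 1) = g (- real n - 1 / real n)" "f (?m - 1) = g (real n - 1 / real n)"
    unfolding f_def using m by (simp_all add: diff_divide_distrib)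
  have edges: "norm (f ?m) \<le> 3 * C / real n" "norm (f (- ?m)) \<le> 3 * C / real n"
      "norm (f (- ?m - 1)) \<le> 3 * C / real n" "norm (f (?m - 1)) \<le> 3 * C / real n"
    unfolding pts by (intro edge; use n1 in linarith)+
  have "p = q - a + b - c + d" if "q = p + (a - b) + (c - d)" for p q a b c d :: complex
    using that by simp
  from this[OF parts] have "norm ((w + inverse w - 2) * ?S) = norm (?D - f ?m * E (?m - 1)
     + f (- ?m) * E (- ?m - 1) - f (- ?m - 1) * E (- ?m) + f (?m - 1) * E ?m)" by (rule arg_cong)
  also have "\<dots> \<le> norm ?D + norm (f ?m * E (?m - 1)) + norm (f (- ?m) * E (- ?m - 1))
     + norm (f (- ?m - 1) * E (- ?m)) + norm (f (?m - 1) * E ?m)"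
  proof -
    have "norm (p - a + b - c + d) \<le> norm p + norm a + norm b + norm c + norm d" for p a b c d :: complex
      using norm_triangle_ineq4[of p a] norm_triangle_ineq[of "p - a" b]
        norm_triangle_ineq4[of "p - a + b" c] norm_triangle_ineq[of "p - a + b - c" d] by linarith
    then show ?thesis .
  qed
  also have "\<dots> \<le> (9 * C * pi) / real n + 3 * C / real n + 3 * C / real n + 3 * C / real n + 3 * C / real n"
    unfolding norm_mult normE mult_1_right by (intro add_mono D edges)
  also have "\<dots> = (9 * C * pi + 12 * C) / real n" by (simp add: add_divide_distrib)
  finally have "norm (w + inverse w - 2) * norm ?S \<le> (9 * C * pi + 12 * C) / real n"
    unfolding norm_mult .
  moreover have "\<theta>\<^sup>2 / 9 * norm ?S \<le> norm (w + inverse w - 2) * norm ?S"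
    using w by (rule mult_right_mono) simp
  ultimately have "\<theta>\<^sup>2 / 9 * norm ?S \<le> (9 * C * pi + 12 * C) / real n" by linarith
  \<comment> \<open>Since \<open>\<theta>\<^sup>2\<close> is
    \<open>pi\<^sup>2 * s\<^sup>2 / n\<^sup>2\<close>, multiplication by \<open>9 * n\<close> leaves
    exactly the factor \<open>1 / n\<close> that normalizes the transform.\<close>
  moreover have "pi\<^sup>2 * (s\<^sup>2 * (S / real n)) \<le> 9 * X" if "\<theta>\<^sup>2 / 9 * S \<le> X / real n" for S X
  proof -
    have "\<theta>\<^sup>2 / 9 * S * (9 * real n) \<le> X / real n * (9 * real n)"
      using that by (rule mult_right_mono) simp
    then show ?thesis using n by (simp add: \<theta>_def power2_eq_square field_simps)
  qed
  ultimately have "pi\<^sup>2 * (s\<^sup>2 * (norm ?S / real n)) \<le> 9 * (9 * C * pi + 12 * C)" by blast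
  moreover have "1 * (s\<^sup>2 * (norm ?S / real n)) \<le> pi\<^sup>2 * (s\<^sup>2 * (norm ?S / real n))"
    using pi_ge_two by (intro mult_right_mono one_le_power) auto
  moreover have "norm (grid_transform g n t) = norm ?S / real n"
    using n by (simp add: grid_transform_eq f_def E_def \<theta>_def s_def norm_divide)
  ultimately show ?thesis unfolding s_def by simp
qed

text \<open>The plain bound and the bound weighted by the squared frequency add up to the weight
  \<open>1 + (grid_point n t)\<^sup>2\<close>. The transform has period \<open>2 * n\<close> in
  \<open>t\<close>, so decay can only be expected on one period around \<open>0\<close>.\<close>

lemma grid_transform_decay:
  obtains K where "K \<ge> 0"
    "\<And>n t. n > 0 \<Longrightarrow> t \<in> {- real n ..< real n} \<Longrightarrow>
       norm (grid_transform g n t) \<le> K / (1 + (grid_point n t)\<^sup>2)"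
proof
  let ?K = "3 * (3 * C) * pi + 9 * (9 * C * pi + 12 * C)"
  show "?K \<ge> 0" using C_nonneg by simp
  fix n t assume "(n::nat) > 0" "t \<in> {- real n ..< real n}"
  then have "norm (grid_transform g n t) + (grid_point n t)\<^sup>2 * norm (grid_transform g n t) \<le> ?K"
    by (intro add_mono grid_transform_bound grid_transform_square_bound)
  then have "norm (grid_transform g n t) * (1 + (grid_point n t)\<^sup>2) \<le> ?K"
    by (simp only: distrib_left mult_1_right mult.commute)
  moreover have "0 < 1 + (grid_point n t)\<^sup>2" by (simp add: add_pos_nonneg)
  ultimately show "norm (grid_transform g n t) \<le> ?K / (1 + (grid_point n t)\<^sup>2)"
    by (simp only: pos_le_divide_eq)
qed

section \<open>Limits of the grid transforms and of their integrals\<close>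

lemma continuous_g: "isCont g x"
  using g1[of x] has_vector_derivative_continuous by blast

lemma borel_measurable_g [measurable]: "g \<in> borel_measurable borel"
  using continuous_g by (intro borel_measurable_continuous_onI) (simp add: continuous_at_imp_continuous_on)

lemma fourier_eq_lborel:
  "fourier g t = (LINT x|lborel. g x * exp (- (of_real pi * \<i> * of_real x * of_real t)))"
  unfolding fourier_def by (rule integral_completion) measurable

text \<open>Grid size and frequency vary together. The exponential factor has norm one, so
  \<open>3 * C / (1 + x\<^sup>2)\<close> dominates all integrands, whatever the frequencies
  are.\<close>

lemma tendsto_grid_transform_sequentially:
  assumes m: "filterlim m at_top sequentially" and t: "t \<longlonglongrightarrow> r"
  shows "(\<lambda>k. grid_transform g (m k) (t k)) \<longlonglongrightarrow> fourier g r"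
proof -
  define s where "s k x = indicator {- real (m k) ..< real (m k)} x *\<^sub>R
     (g (grid_point (m k) x) * grid_exp (m k) (grid_point (m k) x) (t k))" for k x
  have s: "has_bochner_integral lborel (s k) (grid_transform g (m k) (t k))" for k
    using has_bochner_integral_grid[of "m k" "\<lambda>x. g (grid_point (m k) x) * grid_exp (m k) x (t k)"]
    unfolding s_def grid_transform_def by simp
  have "(\<lambda>k. integral\<^sup>L lborel (s k)) \<longlonglongrightarrow>
     (LINT x|lborel. g x * exp (- (of_real pi * \<i> * of_real x * of_real r)))"
  proof (rule integral_dominated_convergence[where w = "\<lambda>x. 3 * C / (1 + x\<^sup>2)"])
    show "s k \<in> borel_measurable lborel" for k using s by (rule borel_measurable_has_bochner_integral)
    show "integrable lborel (\<lambda>x. 3 * C / (1 + x\<^sup>2))"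
      using has_bochner_integral_decay by (simp add: has_bochner_integral_iff)
    show "AE x in lborel. norm (s k x) \<le> 3 * C / (1 + x\<^sup>2)" for k
    proof (intro AE_I2)
      fix x :: real
      show "norm (s k x) \<le> 3 * C / (1 + x\<^sup>2)"
      proof (cases "m k > 0 \<and> x \<in> {- real (m k) ..< real (m k)}")
        case True
        then show ?thesis using decay_grid[OF _ decay, of "m k" x] by (simp add: s_def norm_mult)
      next
        case False
        then have "s k x = 0" by (auto simp: s_def indicator_def)
        then show ?thesis using C_nonneg by (simp add: add_nonneg_nonneg)
      qed
    qed
    show "AE x in lborel. (\<lambda>k. s k x) \<longlonglongrightarrow> g x * exp (- (of_real pi * \<i> * of_real x * of_real r))"
    proof (intro AE_I2)
      fix x :: real
      have gx: "(\<lambda>k. grid_point (m k) x) \<longlonglongrightarrow> x" by (intro tendsto_grid_point m tendsto_const)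
      have "(\<lambda>k. g (grid_point (m k) x) * grid_exp (m k) (grid_point (m k) x) (t k)) \<longlonglongrightarrow>
         g x * exp (- (of_real pi * \<i> * of_real x * of_real r))"
        unfolding grid_exp_def grid_point_grid_point
        by (intro tendsto_intros isCont_tendsto_compose[OF continuous_g] gx tendsto_grid_point m t)
      \<comment> \<open>For fixed \<open>x\<close> the truncation disappears as soon as
        \<open>m k\<close> exceeds \<open>\<bar>x\<bar>\<close>.\<close>
      moreover have "\<forall>\<^sub>F k in sequentially.
         g (grid_point (m k) x) * grid_exp (m k) (grid_point (m k) x) (t k) = s k x"
      proof -
        have "\<forall>\<^sub>F k in sequentially. nat \<lceil>\<bar>x\<bar>\<rceil> < m k"
          using eventually_compose_filterlim[OF eventually_gt_at_top[of "nat \<lceil>\<bar>x\<bar>\<rceil>"] m] .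
        then show ?thesis
        proof eventually_elim
          case (elim k)
          then have "\<bar>x\<bar> < real (m k)" by linarith
          then have "x \<in> {- real (m k) ..< real (m k)}" by auto
          then show ?case by (simp add: s_def)
        qed
      qed
      ultimately show "(\<lambda>k. s k x) \<longlonglongrightarrow> g x * exp (- (of_real pi * \<i> * of_real x * of_real r))"
        by (rule Lim_transform_eventually)
    qed
  qed measurable
  moreover have "integral\<^sup>L lborel (s k) = grid_transform g (m k) (t k)" for k
    using s by (rule has_bochner_integral_integral_eq)
  ultimately show ?thesis by (simp add: fourier_eq_lborel)
qed

text \<open>Dominated convergence is a statement about sequences, whereas the limits needed run
  along ultrafilters. A sequence of counterexamples shows that closeness holds for all large
  \<open>n\<close> and all \<open>s\<close> near \<open>r\<close>, and this form passes to any
  filter.\<close>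

lemma tendsto_grid_transform:
  assumes m: "filterlim m at_top F" and t: "(t \<longlongrightarrow> r) F"
  shows "((\<lambda>i. grid_transform g (m i) (t i)) \<longlongrightarrow> fourier g r) F"
proof (rule tendstoI)
  fix e :: real assume e: "e > 0"
  have "\<exists>k. \<forall>n\<ge>k. \<forall>s. dist s r < 1 / real (Suc k) \<longrightarrow> dist (grid_transform g n s) (fourier g r) < e"
  proof (rule ccontr)
    assume "\<not> ?thesis"
    then have "\<forall>k. \<exists>n s. k \<le> n \<and> dist s r < 1 / real (Suc k) \<and> \<not> dist (grid_transform g n s) (fourier g r) < e"
      by blast
    then obtain n s where ns: "\<And>k. k \<le> n k" "\<And>k. dist (s k) r < 1 / real (Suc k)"
      "\<And>k. \<not> dist (grid_transform g (n k) (s k)) (fourier g r) < e" by metis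
    have "filterlim n at_top sequentially"
      using ns(1) by (intro filterlim_at_top_mono[OF filterlim_ident]) auto
    moreover have "s \<longlonglongrightarrow> r"
    proof -
      have "(\<lambda>k. s k - r) \<longlonglongrightarrow> 0"
      proof (rule Lim_null_comparison)
        show "(\<lambda>k. 1 / real (Suc k)) \<longlonglongrightarrow> 0" using LIMSEQ_Suc[OF lim_1_over_n] .
        show "\<forall>\<^sub>F k in sequentially. norm (s k - r) \<le> 1 / real (Suc k)"
          using ns(2) by (intro always_eventually allI less_imp_le) (simp only: dist_norm)
      qed
      then show ?thesis by (rule LIM_zero_cancel)
    qed
    ultimately have "(\<lambda>k. grid_transform g (n k) (s k)) \<longlonglongrightarrow> fourier g r"
      by (rule tendsto_grid_transform_sequentially)
    then have "\<forall>\<^sub>F k in sequentially. dist (grid_transform g (n k) (s k)) (fourier g r) < e"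
      using e by (rule tendstoD)
    then show False using ns(3) by simp
  qed
  then obtain k where k: "\<And>n s. n \<ge> k \<Longrightarrow> dist s r < 1 / real (Suc k) \<Longrightarrow> dist (grid_transform g n s) (fourier g r) < e"
    by blast
  have "\<forall>\<^sub>F i in F. k \<le> m i" using m by (simp add: filterlim_at_top)
  moreover have "\<forall>\<^sub>F i in F. dist (t i) r < 1 / real (Suc k)" using t by (rule tendstoD) simp
  ultimately show "\<forall>\<^sub>F i in F. dist (grid_transform g (m i) (t i)) (fourier g r) < e"
    by eventually_elim (rule k)
qed

text \<open>The step functions \<open>s n\<close> converge pointwise to the Fourier transform and
  are dominated by \<open>3 * K / (1 + t\<^sup>2)\<close>, thanks to the uniform decay;
  integrability of the limit and convergence of the integrals come from the same
  application.\<close>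

lemma integrable_fourier: "integrable lborel (fourier g)"
  and tendsto_integral_grid_transform:
    "(\<lambda>n. grid_integral n (grid_transform g n)) \<longlonglongrightarrow> (LINT t|lborel. fourier g t)"
proof -
  obtain K where K: "K \<ge> 0" "\<And>n t. n > 0 \<Longrightarrow> t \<in> {- real n ..< real n} \<Longrightarrow>
       norm (grid_transform g n t) \<le> K / (1 + (grid_point n t)\<^sup>2)"
    by (rule grid_transform_decay) blast
  define s where "s n t = indicator {- real n ..< real n} t *\<^sub>R grid_transform g n (grid_point n t)" for n t
  have s: "has_bochner_integral lborel (s n) (grid_integral n (grid_transform g n))" for n
    using has_bochner_integral_grid[of n "grid_transform g n"] by (simp add: s_def[abs_def])
  have meas: "s n \<in> borel_measurable lborel" for n using s by (rule borel_measurable_has_bochner_integral)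
  have lim: "(\<lambda>n. s n t) \<longlonglongrightarrow> fourier g t" for t
  proof (rule Lim_transform_eventually)
    show "(\<lambda>n. grid_transform g n t) \<longlonglongrightarrow> fourier g t"
      by (rule tendsto_grid_transform_sequentially[OF filterlim_ident tendsto_const])
    have "\<forall>\<^sub>F n in sequentially. nat \<lceil>\<bar>t\<bar>\<rceil> < n" by (rule eventually_gt_at_top)
    then show "\<forall>\<^sub>F n in sequentially. grid_transform g n t = s n t"
    proof eventually_elim
      case (elim n)
      then have "\<bar>t\<bar> < real n" by linarith
      then have "t \<in> {- real n ..< real n}" by auto
      then show ?case by (simp add: s_def)
    qed
  qed
  have fm: "fourier g \<in> borel_measurable lborel"
    by (rule borel_measurable_LIMSEQ_metric[OF meas lim])
  have w: "integrable lborel (\<lambda>x. 3 * K / (1 + x\<^sup>2))"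
    using has_bochner_integral_decay by (simp add: has_bochner_integral_iff)
  have bound: "norm (s n t) \<le> 3 * K / (1 + t\<^sup>2)" for n t
  proof (cases "n > 0 \<and> t \<in> {- real n ..< real n}")
    case True
    then have "norm (s n t) \<le> K / (1 + (grid_point n t)\<^sup>2)" using K(2) by (simp add: s_def)
    moreover have "norm (K / (1 + (grid_point n t)\<^sup>2)) \<le> 3 * K / (1 + t\<^sup>2)"
      using True K(1) by (intro decay_grid) (auto simp: add_nonneg_nonneg)
    ultimately show ?thesis using K(1) by simp
  next
    case False
    then have "s n t = 0" by (auto simp: s_def indicator_def)
    then show ?thesis using K(1) by (simp add: add_nonneg_nonneg)
  qed
  have "(\<lambda>n. integral\<^sup>L lborel (s n)) \<longlonglongrightarrow> integral\<^sup>L lborel (fourier g)"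
    by (rule integral_dominated_convergence[OF fm meas w]) (use lim bound in auto)
  then show "(\<lambda>n. grid_integral n (grid_transform g n)) \<longlonglongrightarrow> (LINT t|lborel. fourier g t)"
    by (simp only: has_bochner_integral_integral_eq[OF s])
  show "integrable lborel (fourier g)"
    by (rule integrable_dominated_convergence[where s = s, OF fm meas w]) (use lim bound in auto)
qed

end

section \<open>Hyperobjects as limits along an ultrafilter\<close>

context germ
begin

lemma eventually_not_iff: "(\<forall>\<^sub>F i in T. \<not> P i) \<longleftrightarrow> \<not> eventually P T"
proof
  show "\<forall>\<^sub>F i in T. \<not> P i \<Longrightarrow> \<not> eventually P T"
    using nontrivial by (auto simp: eventually_False[symmetric] dest: eventually_conj)
qed (rule ultra)

lemma eventually_disj_iff: "(\<forall>\<^sub>F i in T. P i \<or> Q i) \<longleftrightarrow> eventually P T \<or> eventually Q T"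
proof
  assume ev: "\<forall>\<^sub>F i in T. P i \<or> Q i"
  show "eventually P T \<or> eventually Q T"
  proof (cases "eventually P T")
    case False
    from ultra[OF this] ev have "eventually Q T" by eventually_elim simp
    then show ?thesis ..
  qed simp
qed (auto elim: eventually_mono)

lemma los2: "[ev f, ev g] \<in> star N R \<longleftrightarrow> (\<forall>\<^sub>F i in T. [f i, g i] \<in> R)"
  using los[of "[f, g]"] by simp

lemma los3: "[ev f, ev g, ev h] \<in> star N R \<longleftrightarrow> (\<forall>\<^sub>F i in T. [f i, g i, h i] \<in> R)"
  using los[of "[f, g, h]"] by simp

lemma ev_eq_iff: "ev f = ev g \<longleftrightarrow> (\<forall>\<^sub>F i in T. f i = g i)"
  using los2[of f g "{us. us ! 0 = us ! 1}", unfolded star_eq] by simp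

lemma ap_ev:
  assumes "\<forall>\<^sub>F i in T. \<forall>v. map (\<lambda>f. f i) fs @ [v] \<in> R \<longleftrightarrow> v = h i"
  shows "ap N R (map ev fs) = ev h"
proof (rule ap_eqI)
  show "map ev fs \<in> star N {us. \<exists>!u. us @ [u] \<in> R}"
    unfolding los using assms by eventually_elim auto
  have "map ev (fs @ [h]) \<in> star N R"
    unfolding los using assms by eventually_elim auto
  then show "map ev fs @ [ev h] \<in> star N R" by simp
qed

lemma hfinite_ev: "hfinite N (ev (\<lambda>i. Rl (f i))) \<longleftrightarrow> (\<exists>r. \<forall>\<^sub>F i in T. \<bar>f i\<bar> \<le> r)"
  unfolding hfinite_def ev_const[symmetric] los2 by simp

lemma happrox_ev:
  "happrox N (ev (\<lambda>i. Rl (f i))) (ev (\<lambda>i. Rl (g i))) \<longleftrightarrow> ((\<lambda>i. f i - g i) \<longlongrightarrow> 0) T"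
  unfolding happrox_def ev_const[symmetric] los3 by (simp add: tendsto_iff dist_norm)

lemma happrox_emb_iff: "happrox N (ev (\<lambda>i. Rl (f i))) (emb N (Rl r)) \<longleftrightarrow> (f \<longlongrightarrow> r) T"
  unfolding ev_const[symmetric] happrox_ev by (rule LIM_zero_iff)

lemma infinitesimal_ev: "infinitesimal N (ev (\<lambda>i. Rl (f i))) \<longleftrightarrow> (f \<longlongrightarrow> 0) T"
  unfolding infinitesimal_def by (rule happrox_emb_iff)

lemma std_part_ev: "(f \<longlongrightarrow> r) T \<Longrightarrow> std_part N (ev (\<lambda>i. Rl (f i))) = r"
  unfolding std_part_def happrox_emb_iff
  by (rule the_equality) (auto intro: tendsto_unique[OF nontrivial])

text \<open>Compactness gives a cluster point. For an ultrafilter it is a limit: if some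
  neighbourhood were not eventually entered, it would eventually be avoided.\<close>

lemma compact_convergent:
  fixes f :: "'i \<Rightarrow> 'b::topological_space"
  assumes "compact S" "\<forall>\<^sub>F i in T. f i \<in> S"
  shows "\<exists>l\<in>S. (f \<longlongrightarrow> l) T"
proof -
  have "filtermap f T \<noteq> bot" using nontrivial by (simp add: filtermap_bot_iff)
  moreover have "\<forall>\<^sub>F x in filtermap f T. x \<in> S" using assms(2) by (simp add: eventually_filtermap)
  ultimately obtain l where l: "l \<in> S" "inf (nhds l) (filtermap f T) \<noteq> bot"
    using assms(1) unfolding compact_filter by blast
  have "(f \<longlongrightarrow> l) T"
  proof (rule topological_tendstoI, rule ccontr)
    fix U assume U: "open U" "l \<in> U" and "\<not> (\<forall>\<^sub>F i in T. f i \<in> U)"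
    then have "\<forall>\<^sub>F x in filtermap f T. x \<notin> U" using ultra by (simp add: eventually_filtermap)
    moreover have "\<forall>\<^sub>F x in nhds l. x \<in> U" using U by (rule eventually_nhds_in_open)
    ultimately have "eventually (\<lambda>_. False) (inf (nhds l) (filtermap f T))"
      unfolding eventually_inf by (metis (mono_tags))
    then show False using l(2) by (simp add: eventually_False)
  qed
  with l(1) show ?thesis by blast
qed

lemma bounded_convergent:
  fixes f :: "'i \<Rightarrow> real"
  assumes "\<forall>\<^sub>F i in T. \<bar>f i\<bar> \<le> r"
  shows "\<exists>l. (f \<longlongrightarrow> l) T"
proof -
  have "\<forall>\<^sub>F i in T. f i \<in> {- r..r}" using assms by eventually_elim auto
  then show ?thesis using compact_convergent[of "{- r..r}" f] by auto
qed

lemma hfinite_iff_convergent: "hfinite N (ev (\<lambda>i. Rl (f i))) \<longleftrightarrow> (\<exists>l. (f \<longlongrightarrow> l) T)"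
proof
  assume "\<exists>l. (f \<longlongrightarrow> l) T"
  then obtain l where "(f \<longlongrightarrow> l) T" ..
  then have "\<forall>\<^sub>F i in T. dist (f i) l < 1" by (rule tendstoD) simp
  then have "\<forall>\<^sub>F i in T. \<bar>f i\<bar> \<le> \<bar>l\<bar> + 1" by eventually_elim (auto simp: dist_real_def)
  then show "hfinite N (ev (\<lambda>i. Rl (f i)))" unfolding hfinite_ev by blast
qed (auto simp: hfinite_ev intro: bounded_convergent)

lemma hRe_ev: "hRe N (ev (\<lambda>i. Cx (f i))) = ev (\<lambda>i. Rl (Re (f i)))"
  unfolding hRe_def using ap_ev[of "[\<lambda>i. Cx (f i)]" _ "\<lambda>i. Rl (Re (f i))"] by simp

lemma hIm_ev: "hIm N (ev (\<lambda>i. Cx (f i))) = ev (\<lambda>i. Rl (Im (f i)))"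
  unfolding hIm_def using ap_ev[of "[\<lambda>i. Cx (f i)]" _ "\<lambda>i. Rl (Im (f i))"] by simp

lemma complex_std_part:
  assumes "(f \<longlongrightarrow> z) T"
  shows "hcfinite N (ev (\<lambda>i. Cx (f i)))" "cstd_part N (ev (\<lambda>i. Cx (f i))) = z"
proof -
  have *: "((\<lambda>i. Re (f i)) \<longlongrightarrow> Re z) T" "((\<lambda>i. Im (f i)) \<longlongrightarrow> Im z) T"
    using assms by (auto intro: tendsto_intros)
  show "hcfinite N (ev (\<lambda>i. Cx (f i)))"
    unfolding hcfinite_def hRe_ev hIm_ev hfinite_iff_convergent using * by blast
  show "cstd_part N (ev (\<lambda>i. Cx (f i))) = z"
    unfolding cstd_part_def hRe_ev hIm_ev by (simp add: std_part_ev[OF *(1)] std_part_ev[OF *(2)])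
qed

lemma elems_ev: "ev (\<lambda>i. Rl (t i)) \<in> elems N (ev (\<lambda>i. St (a i))) \<longleftrightarrow> (\<forall>\<^sub>F i in T. t i \<in> a i)"
  unfolding elems_def mem_Collect_eq los2 by simp

lemma rval_ev: "rval N (ev (\<lambda>i. RFun (f i))) (ev (\<lambda>i. Rl (t i))) = ev (\<lambda>i. Rl (f i (t i)))"
  unfolding rval_def
  using ap_ev[of "[\<lambda>i. RFun (f i), \<lambda>i. Rl (t i)]" _ "\<lambda>i. Rl (f i (t i))"] by simp

lemma cval_ev: "cval N (ev (\<lambda>i. CFun (f i))) (ev (\<lambda>i. Rl (t i))) = ev (\<lambda>i. Cx (f i (t i)))"
  unfolding cval_def
  using ap_ev[of "[\<lambda>i. CFun (f i), \<lambda>i. Rl (t i)]" _ "\<lambda>i. Cx (f i (t i))"] by simp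

end

locale hypergrid = germ +
  fixes \<eta> and \<nu>
  assumes \<eta>: "\<eta> = ev (\<lambda>i. Rl (real (\<nu> i)))" and \<nu>: "filterlim \<nu> at_top T"
begin

lemma eventually_\<nu>: "\<forall>\<^sub>F i in T. m < \<nu> i"
  using eventually_compose_filterlim[OF eventually_gt_at_top[of m] \<nu>] .

lemma Rbar_ev: "Rbar N \<eta> = ev (\<lambda>i. St {- real (\<nu> i) ..< real (\<nu> i)})"
  unfolding Rbar_def \<eta>
  using ap_ev[of "[\<lambda>i. Rl (real (\<nu> i))]" _ "\<lambda>i. St {- real (\<nu> i) ..< real (\<nu> i)}"] by simp

lemma grid_sets_ev: "ev (\<lambda>i. St (a i)) \<in> grid_sets N \<eta> \<longleftrightarrow> (\<forall>\<^sub>F i in T. a i \<in> grid_algebra (\<nu> i))"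
  unfolding grid_sets_def \<eta> mem_Collect_eq los2 by simp

lemma lam_ev: "lam N \<eta> (ev (\<lambda>i. St (a i))) = ev (\<lambda>i. Rl (grid_measure (\<nu> i) (a i)))"
  unfolding lam_def \<eta>
  using ap_ev[of "[\<lambda>i. Rl (real (\<nu> i)), \<lambda>i. St (a i)]" _ "\<lambda>i. Rl (grid_measure (\<nu> i) (a i))"] by simp

lemma cintegral_ev: "cintegral N \<eta> (ev (\<lambda>i. CFun (f i))) = ev (\<lambda>i. Cx (grid_integral (\<nu> i) (f i)))"
  unfolding cintegral_def \<eta>
  using ap_ev[of "[\<lambda>i. Rl (real (\<nu> i)), \<lambda>i. CFun (f i)]" _ "\<lambda>i. Cx (grid_integral (\<nu> i) (f i))"] by simp

lemma abs_integral_on_ev: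
  "abs_integral_on N \<eta> (ev (\<lambda>i. St (a i))) (ev (\<lambda>i. RFun (f i))) =
     ev (\<lambda>i. Rl (grid_integral (\<nu> i) (\<lambda>x. indicator (a i) x * \<bar>f i x\<bar>)))"
  unfolding abs_integral_on_def \<eta>
  using ap_ev[of "[\<lambda>i. Rl (real (\<nu> i)), \<lambda>i. St (a i), \<lambda>i. RFun (f i)]" _
      "\<lambda>i. Rl (grid_integral (\<nu> i) (\<lambda>x. indicator (a i) x * \<bar>f i x\<bar>))"] by simp

lemma grid_measurable_ev:
  "grid_measurable N \<eta> (ev (\<lambda>i. RFun (f i))) \<longleftrightarrow>
    (\<forall>\<^sub>F i in T. f i \<in> borel_measurable (sigma {- real (\<nu> i) ..< real (\<nu> i)} (grid_algebra (\<nu> i))))"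
  unfolding grid_measurable_def \<eta> los2 by simp

text \<open>As \<open>g\<close> is standard, it is a constant family, and \<open>ghat\<close> has
  the same formula in every germ containing \<eta>. Germs therefore need no coordinate for internal
  functions.\<close>

lemma grid_fourier_grid_fun_ev:
  "grid_fourier N \<eta> (grid_fun N \<eta> g) = ev (\<lambda>i. CFun (grid_transform g (\<nu> i)))"
proof -
  have "grid_fun N \<eta> g = ev (\<lambda>i. CFun (\<lambda>x. g (grid_point (\<nu> i) x)))"
    unfolding grid_fun_def \<eta> ev_const[symmetric]
    using ap_ev[of "[\<lambda>i. Rl (real (\<nu> i)), \<lambda>i. CFun g]" _ "\<lambda>i. CFun (\<lambda>x. g (grid_point (\<nu> i) x))"] by simp
  then show ?thesis
    unfolding grid_fourier_def \<eta>
    using ap_ev[of "[\<lambda>i. Rl (real (\<nu> i)), \<lambda>i. CFun (\<lambda>x. g (grid_point (\<nu> i) x))]" _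
       "\<lambda>i. CFun (grid_transform g (\<nu> i))"]
    by (simp add: grid_transform_def[abs_def])
qed

end

text \<open>The type \<open>'h\<close> mixes numbers, sets and functions. This predicate and
  \<open>hyperreal\<close> record the sort of a hyperobject, which must be known before it can
  become a coordinate of a germ.\<close>

definition hyperset :: "'h extension \<Rightarrow> 'h \<Rightarrow> bool" where
  "hyperset N A \<longleftrightarrow> [A] \<in> star N {[St B] |B. True}"

definition hyperreal :: "'h extension \<Rightarrow> 'h \<Rightarrow> bool" where
  "hyperreal N t \<longleftrightarrow> [t] \<in> star N {[Rl r] |r. True}"

section \<open>Germs containing a given infinite grid size\<close>

locale infinite_grid = extension +
  fixes \<eta>
  assumes infinite: "\<eta> \<in> hypernats N - standard_nats N"
begin

lemma hyperset_grid_sets: "A \<in> grid_sets N \<eta> \<Longrightarrow> hyperset N A"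
  unfolding grid_sets_def hyperset_def mem_Collect_eq
  using star_reindex[of "[1]" "[\<eta>, A]" "{[St B] |B. True}"] by (auto elim: star_mono)

lemma hyperreal_elems: "t \<in> elems N A \<Longrightarrow> hyperreal N t"
  unfolding elems_def hyperreal_def mem_Collect_eq
  using star_reindex[of "[0]" "[t, A]" "{[Rl r] |r. True}"] by (auto elim: star_mono)

lemma hyperset_emb: "hyperset N (emb N (St B))"
  unfolding hyperset_def using star_emb[of "[St B]"] by simp

lemma hyperreal_emb: "hyperreal N (emb N (Rl r))"
  unfolding hyperreal_def using star_emb[of "[Rl r]"] by simp

text \<open>Two internal sets and one point, besides \<eta>, are as much as any later argument has
  to present at once, so one index type serves throughout; spare places are filled with embedded
  objects.\<close>

lemma hypergrid_exists:
  assumes "hyperset N A" "hyperset N B" "hyperreal N t"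
  obtains T :: "(nat \<times> real set \<times> real set \<times> real) filter" and ev \<nu> a b \<tau>
  where "hypergrid N T ev \<eta> \<nu>" "A = ev (\<lambda>i. St (a i))" "B = ev (\<lambda>i. St (b i))" "t = ev (\<lambda>i. Rl (\<tau> i))"
proof -
  define e where "e = (\<lambda>(n, B, C, r). [Rl (real n), St B, St C, Rl r])"
  have "inj e" by (auto simp: e_def inj_def)
  have "[\<eta>, A, B, t] \<in> star N ({us. length us = length [\<eta>, A, B, t]} \<inter>
      {us. [us ! 0] \<in> {[Rl (real n)] |n. True}} \<inter> {us. [us ! 1] \<in> {[St B] |B. True}} \<inter>
      {us. [us ! 2] \<in> {[St B] |B. True}} \<inter> {us. [us ! 3] \<in> {[Rl r] |r. True}})"
    using assms infinite star_length[of "[\<eta>, A, B, t]"]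
      star_reindex[of "[0]" "[\<eta>, A, B, t]" "{[Rl (real n)] |n. True}"]
      star_reindex[of "[1]" "[\<eta>, A, B, t]" "{[St B] |B. True}"]
      star_reindex[of "[2]" "[\<eta>, A, B, t]" "{[St B] |B. True}"]
      star_reindex[of "[3]" "[\<eta>, A, B, t]" "{[Rl r] |r. True}"]
    by (simp add: star_Int hyperset_def hyperreal_def hypernats_def)
  then have "[\<eta>, A, B, t] \<in> star N (range e)"
  proof (rule star_mono, intro subsetI)
    fix us :: "univ list"
    assume us: "us \<in> {us. length us = length [\<eta>, A, B, t]} \<inter>
      {us. [us ! 0] \<in> {[Rl (real n)] |n. True}} \<inter> {us. [us ! 1] \<in> {[St B] |B. True}} \<inter>
      {us. [us ! 2] \<in> {[St B] |B. True}} \<inter> {us. [us ! 3] \<in> {[Rl r] |r. True}}"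
    then obtain n B C r where "us ! 0 = Rl (real n)" "us ! 1 = St B" "us ! 2 = St C" "us ! 3 = Rl r"
      by auto
    moreover have "us = [us ! 0, us ! 1, us ! 2, us ! 3]"
      using us by (auto intro!: nth_equalityI simp: less_Suc_eq numeral_eq_Suc)
    ultimately have "us = e (n, B, C, r)" by (simp add: e_def)
    then show "us \<in> range e" by blast
  qed
  from germ_exists[OF \<open>inj e\<close> this] obtain T ev where ge: "germ N T ev"
    "\<And>j. j < length [\<eta>, A, B, t] \<Longrightarrow> ev (\<lambda>i. e i ! j) = [\<eta>, A, B, t] ! j" by blast
  interpret germ N T ev by fact
  define \<nu> where "\<nu> i = fst i" for i :: "nat \<times> real set \<times> real set \<times> real"
  have \<eta>: "\<eta> = ev (\<lambda>i. Rl (real (\<nu> i)))"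
    using ge(2)[of 0] by (simp add: e_def \<nu>_def case_prod_beta)
  have ABt: "A = ev (\<lambda>i. St (fst (snd i)))" "B = ev (\<lambda>i. St (fst (snd (snd i))))"
    "t = ev (\<lambda>i. Rl (snd (snd (snd i))))"
    using ge(2)[of 1] ge(2)[of 2] ge(2)[of 3] by (simp_all add: e_def case_prod_beta)
  \<comment> \<open>Since \<eta> differs from every standard natural, the family avoids each
    \<open>m\<close> on a large set, hence finitely many of them together, and so tends to
    infinity.\<close>
  have "\<forall>\<^sub>F i in T. \<nu> i \<noteq> m" for m
  proof -
    have "\<eta> \<noteq> emb N (Rl (real m))" using infinite by (auto simp: standard_nats_def)
    then have "\<not> (\<forall>\<^sub>F i in T. \<nu> i = m)" unfolding \<eta> ev_const[symmetric] ev_eq_iff by simp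
    then show ?thesis by (rule ultra)
  qed
  then have "\<forall>\<^sub>F i in T. \<forall>m\<in>{..<Z}. \<nu> i \<noteq> m" for Z by (intro eventually_ball_finite) auto
  then have "\<forall>\<^sub>F i in T. Z \<le> \<nu> i" for Z
    by (rule eventually_mono[of "\<lambda>i. \<forall>m\<in>{..<Z}. \<nu> i \<noteq> m"]) (metis lessThan_iff not_le)
  then have "filterlim \<nu> at_top T" by (simp add: filterlim_at_top)
  with \<eta> have "hypergrid N T ev \<eta> \<nu>" by unfold_locales
  from that[OF this ABt] show thesis .
qed

lemma hypergrid_exists_point:
  assumes "hyperreal N t"
  obtains T :: "(nat \<times> real set \<times> real set \<times> real) filter" and ev \<nu> \<tau>
  where "hypergrid N T ev \<eta> \<nu>" "t = ev (\<lambda>i. Rl (\<tau> i))"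
  using hypergrid_exists[OF hyperset_emb hyperset_emb assms] by metis

end

section \<open>The grid algebra\<close>

text \<open>Unions of cells are coded by sets of integer indices; set operations then act on the
  indices, and the grid measure counts them.\<close>

definition cells :: "nat \<Rightarrow> int set \<Rightarrow> real set" where
  "cells n K = {x. \<lfloor>real n * x\<rfloor> \<in> K}"

lemma point_in_cells_iff: "n > 0 \<Longrightarrow> of_int k / real n \<in> cells n K \<longleftrightarrow> k \<in> K"
  by (simp add: cells_def)

lemma grid_algebra_eq:
  assumes "n > 0"
  shows "grid_algebra n = {cells n K |K. K \<subseteq> {- (int n)\<^sup>2 ..< (int n)\<^sup>2}}"
proof -
  have "(\<Union>k\<in>K. {of_int k / real n ..< (of_int k + 1) / real n}) = cells n K" for K
    by (auto simp: cells_def cell_iff[OF assms] simp del: atLeastLessThan_iff)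
  then show ?thesis by (simp add: grid_algebra_def)
qed

lemma grid_measure_cells:
  assumes n: "n > 0" and K: "K \<subseteq> {- (int n)\<^sup>2 ..< (int n)\<^sup>2}"
  shows "grid_measure n (cells n K) = real (card K) / real n"
proof -
  have "{of_int k / real n ..< (of_int k + 1) / real n} \<subseteq> cells n K \<longleftrightarrow> k \<in> K" for k
  proof
    assume "{of_int k / real n ..< (of_int k + 1) / real n} \<subseteq> cells n K"
    moreover have "of_int k / real n \<in> {of_int k / real n ..< (of_int k + 1) / real n}"
      using n by (simp add: divide_strict_right_mono)
    ultimately show "k \<in> K" using point_in_cells_iff[OF n] by blast
  next
    assume "k \<in> K"
    then show "{of_int k / real n ..< (of_int k + 1) / real n} \<subseteq> cells n K"
      by (auto simp: cells_def cell_iff[OF n] simp del: atLeastLessThan_iff)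
  qed
  then have "{k \<in> {- (int n)\<^sup>2 ..< (int n)\<^sup>2}. {of_int k / real n ..< (of_int k + 1) / real n} \<subseteq> cells n K} = K"
    using K by blast
  then show ?thesis by (simp add: grid_measure_def)
qed

lemma grid_measure_nonneg: "grid_measure n A \<ge> 0"
  by (simp add: grid_measure_def)

lemma grid_algebra_subset:
  assumes "n > 0" "A \<in> grid_algebra n"
  shows "A \<subseteq> {- real n ..< real n}"
  using assms(2) floor_in_grid[OF assms(1)] unfolding grid_algebra_eq[OF assms(1)] cells_def by blast

lemma grid_algebra_Un:
  assumes "n > 0" "A \<in> grid_algebra n" "B \<in> grid_algebra n"
  shows "A \<union> B \<in> grid_algebra n"
proof -
  obtain K L where KL: "A = cells n K" "B = cells n L"
    "K \<union> L \<subseteq> {- (int n)\<^sup>2 ..< (int n)\<^sup>2}"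
    using assms unfolding grid_algebra_eq[OF assms(1)] by blast
  then have "A \<union> B = cells n (K \<union> L)" by (auto simp: cells_def)
  with KL show ?thesis unfolding grid_algebra_eq[OF assms(1)] by blast
qed

lemma grid_algebra_Diff:
  assumes "n > 0" "A \<in> grid_algebra n"
  shows "{- real n ..< real n} - A \<in> grid_algebra n"
proof -
  let ?I = "{- (int n)\<^sup>2 ..< (int n)\<^sup>2}"
  obtain K where K: "A = cells n K" "K \<subseteq> ?I"
    using assms unfolding grid_algebra_eq[OF assms(1)] by blast
  then have "{- real n ..< real n} - A = cells n (?I - K)"
    using floor_in_grid[OF assms(1)] unfolding cells_def by blast
  moreover have "?I - K \<subseteq> ?I" by blast
  ultimately show ?thesis unfolding grid_algebra_eq[OF assms(1)] by blast
qed

lemma grid_measure_additive: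
  assumes n: "n > 0" and "A \<in> grid_algebra n" "B \<in> grid_algebra n" and "A \<inter> B = {}"
  shows "grid_measure n (A \<union> B) = grid_measure n A + grid_measure n B"
proof -
  let ?I = "{- (int n)\<^sup>2 ..< (int n)\<^sup>2}"
  obtain K L where KL: "A = cells n K" "B = cells n L" "K \<subseteq> ?I" "L \<subseteq> ?I"
    using assms unfolding grid_algebra_eq[OF n] by blast
  have "K \<inter> L = {}" using assms(4) KL point_in_cells_iff[OF n] by blast
  moreover have "finite K" "finite L" using KL finite_subset[OF _ finite_atLeastLessThan_int] by blast+
  moreover have "A \<union> B = cells n (K \<union> L)" using KL by (auto simp: cells_def)
  moreover have "K \<union> L \<subseteq> ?I" using KL by blast
  ultimately show ?thesis
    using KL by (simp only: grid_measure_cells[OF n] card_Un_disjoint of_nat_add add_divide_distrib)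
qed

text \<open>The endpoints are compared with the grid point rather than with \<open>x\<close>, so
  that real endpoints off the grid still give a union of cells.\<close>

definition grid_interval :: "nat \<Rightarrow> real \<Rightarrow> real \<Rightarrow> real set" where
  "grid_interval n a b = {x \<in> {- real n ..< real n}. a \<le> grid_point n x \<and> grid_point n x < b}"

lemma grid_interval_eq_cells:
  assumes "n > 0"
  shows "grid_interval n a b =
    cells n {k \<in> {- (int n)\<^sup>2 ..< (int n)\<^sup>2}. a \<le> of_int k / real n \<and> of_int k / real n < b}"
  unfolding grid_interval_def cells_def grid_point_def using floor_in_grid[OF assms] by blast

lemma grid_interval_in_grid_algebra: "n > 0 \<Longrightarrow> grid_interval n a b \<in> grid_algebra n"
  unfolding grid_interval_eq_cells grid_algebra_eq by blast

text \<open>The left ends of the cells counted are the multiples of \<open>1 / n\<close> in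
  \<open>[a, b)\<close>. Their number is a difference of two ceilings, off from
  \<open>n * (b - a)\<close> by at most one.\<close>

lemma tendsto_grid_measure_interval:
  assumes "a \<le> b"
  shows "(\<lambda>n. grid_measure n (grid_interval n a b)) \<longlonglongrightarrow> b - a"
proof -
  have "(\<lambda>n. grid_measure n (grid_interval n a b) - (b - a)) \<longlonglongrightarrow> 0"
  proof (rule Lim_null_comparison)
    show "(\<lambda>n. 1 / real n) \<longlonglongrightarrow> 0" by (rule lim_1_over_n)
    \<comment> \<open>Beyond this size the truncation to \<open>[-n, n)\<close> removes nothing from
      the interval.\<close>
    have "\<forall>\<^sub>F n in sequentially. nat \<lceil>\<bar>a\<bar> + \<bar>b\<bar>\<rceil> < n" by (rule eventually_gt_at_top)
    then show "\<forall>\<^sub>F n in sequentially. norm (grid_measure n (grid_interval n a b) - (b - a)) \<le> 1 / real n"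
    proof eventually_elim
      case (elim n)
      then have ab: "\<bar>a\<bar> + \<bar>b\<bar> < real n" and n: "n > 0" by linarith+
      let ?I = "{- (int n)\<^sup>2 ..< (int n)\<^sup>2}"
      have K: "{k \<in> ?I. a \<le> of_int k / real n \<and> of_int k / real n < b} = {\<lceil>real n * a\<rceil> ..< \<lceil>real n * b\<rceil>}"
      proof (intro equalityI subsetI)
        fix k assume "k \<in> {k \<in> ?I. a \<le> of_int k / real n \<and> of_int k / real n < b}"
        then show "k \<in> {\<lceil>real n * a\<rceil> ..< \<lceil>real n * b\<rceil>}"
          using n by (simp add: ceiling_le_iff less_ceiling_iff pos_le_divide_eq pos_divide_less_eq mult.commute)
      next
        fix k assume "k \<in> {\<lceil>real n * a\<rceil> ..< \<lceil>real n * b\<rceil>}"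
        then have k: "a \<le> of_int k / real n" "of_int k / real n < b"
          using n by (simp_all add: ceiling_le_iff less_ceiling_iff pos_le_divide_eq pos_divide_less_eq mult.commute)
        then have "of_int k / real n \<in> {- real n ..< real n}" using ab by auto
        then have "k \<in> ?I" using floor_in_grid[OF n, of "of_int k / real n"] n by simp
        with k show "k \<in> {k \<in> ?I. a \<le> of_int k / real n \<and> of_int k / real n < b}" by blast
      qed
      have "grid_measure n (grid_interval n a b) =
          real (card {k \<in> ?I. a \<le> of_int k / real n \<and> of_int k / real n < b}) / real n"
        unfolding grid_interval_eq_cells[OF n] by (rule grid_measure_cells[OF n]) blast
      also have "real (card {k \<in> ?I. a \<le> of_int k / real n \<and> of_int k / real n < b}) =
          real_of_int (\<lceil>real n * b\<rceil> - \<lceil>real n * a\<rceil>)"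
      proof -
        have "\<lceil>real n * a\<rceil> \<le> \<lceil>real n * b\<rceil>" using assms by (intro ceiling_mono mult_left_mono) auto
        then show ?thesis unfolding K card_atLeastLessThan_int
          by (intro of_nat_nat) (simp only: diff_ge_0_iff_ge)
      qed
      finally have eq: "grid_measure n (grid_interval n a b) = real_of_int (\<lceil>real n * b\<rceil> - \<lceil>real n * a\<rceil>) / real n" .
      have "\<bar>real_of_int (\<lceil>real n * b\<rceil> - \<lceil>real n * a\<rceil>) - real n * (b - a)\<bar> \<le> 1"
        using ceiling_correct[of "real n * a"] ceiling_correct[of "real n * b"]
        unfolding right_diff_distrib of_int_diff abs_le_iff by linarith
      then have "\<bar>real_of_int (\<lceil>real n * b\<rceil> - \<lceil>real n * a\<rceil>) - real n * (b - a)\<bar> / real n \<le> 1 / real n"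
        by (rule divide_right_mono) simp
      moreover have "grid_measure n (grid_interval n a b) - (b - a) =
          (real_of_int (\<lceil>real n * b\<rceil> - \<lceil>real n * a\<rceil>) - real n * (b - a)) / real n"
        unfolding eq using n by (simp add: diff_divide_distrib)
      ultimately show ?case by (simp add: abs_divide)
    qed
  qed
  then show ?thesis by (rule LIM_zero_cancel)
qed

text \<open>A function constant on cells pulls every set back to a union of cells, and all such
  unions within the grid are in the algebra.\<close>

lemma grid_measurable_step:
  fixes f :: "real \<Rightarrow> real"
  assumes n: "n > 0" and f: "\<And>x. f (grid_point n x) = f x"
  shows "f \<in> borel_measurable (sigma {- real n ..< real n} (grid_algebra n))"
proof (rule measurableI)
  let ?I = "{- (int n)\<^sup>2 ..< (int n)\<^sup>2}"
  have sub: "grid_algebra n \<subseteq> Pow {- real n ..< real n}"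
    using grid_algebra_subset[OF n] by blast
  fix S :: "real set"
  have "f -` S \<inter> {- real n ..< real n} = cells n {k \<in> ?I. f (of_int k / real n) \<in> S}"
    using floor_in_grid[OF n] f unfolding cells_def grid_point_def by fastforce
  then have "f -` S \<inter> {- real n ..< real n} \<in> grid_algebra n"
    unfolding grid_algebra_eq[OF n] by blast
  then show "f -` S \<inter> space (sigma {- real n ..< real n} (grid_algebra n)) \<in>
      sets (sigma {- real n ..< real n} (grid_algebra n))"
    using sub by simp
qed simp

section \<open>Estimates for grid integrals\<close>

lemma grid_integral_mono:
  fixes f h :: "real \<Rightarrow> real"
  assumes "\<And>k. k \<in> {- (int n)\<^sup>2 ..< (int n)\<^sup>2} \<Longrightarrow> f (of_int k / real n) \<le> h (of_int k / real n)"
  shows "grid_integral n f \<le> grid_integral n h"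
  unfolding grid_integral_def using assms by (intro divide_right_mono sum_mono) auto

lemma grid_integral_nonneg:
  fixes f :: "real \<Rightarrow> real"
  assumes "\<And>x. 0 \<le> f x"
  shows "0 \<le> grid_integral n f"
  unfolding grid_integral_def using assms by (intro divide_nonneg_nonneg sum_nonneg) auto

lemma grid_integral_indicator:
  assumes n: "n > 0" and A: "A \<in> grid_algebra n"
  shows "grid_integral n (\<lambda>x. indicator A x * (c::real)) = c * grid_measure n A"
proof -
  let ?I = "{- (int n)\<^sup>2 ..< (int n)\<^sup>2}"
  obtain K where K: "A = cells n K" "K \<subseteq> ?I"
    using A unfolding grid_algebra_eq[OF n] by blast
  have "(\<Sum>k\<in>?I. indicator A (of_int k / real n) * c) = (\<Sum>k\<in>?I. if k \<in> K then c else 0)"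
    by (intro sum.cong refl) (simp add: K(1) indicator_def point_in_cells_iff[OF n])
  also have "\<dots> = (\<Sum>k\<in>?I \<inter> K. c)"
    by (rule sum.inter_restrict[symmetric]) (rule finite_atLeastLessThan_int)
  also have "?I \<inter> K = K" using K(2) by blast
  finally show ?thesis
    unfolding grid_integral_def by (simp add: K(1) grid_measure_cells[OF n K(2)])
qed

text \<open>Prepares the S-integrability condition on sets where the function is infinitesimal.
  There it is below any standard level and also below the decay bound, and the integral of the
  minimum of the two vanishes with the level.\<close>

lemma tendsto_integral_min_decay:
  assumes "K \<ge> 0"
  shows "(\<lambda>j. LINT x|lborel. min (1 / real (Suc j)) (K / (1 + x\<^sup>2))) \<longlonglongrightarrow> 0"
proof -
  have "(\<lambda>j. LINT x|lborel. min (1 / real (Suc j)) (K / (1 + x\<^sup>2))) \<longlonglongrightarrow> (LINT x|(lborel::real measure). 0)"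
  proof (rule integral_dominated_convergence[where w = "\<lambda>x. K / (1 + x\<^sup>2)"])
    show "integrable lborel (\<lambda>x. K / (1 + x\<^sup>2))"
      using has_bochner_integral_decay by (simp add: has_bochner_integral_iff)
    show "AE x in lborel. norm (min (1 / real (Suc j)) (K / (1 + x\<^sup>2))) \<le> K / (1 + x\<^sup>2)" for j
      using assms by (intro AE_I2) (auto simp: min_def abs_if add_nonneg_nonneg)
    show "AE x in lborel. (\<lambda>j. min (1 / real (Suc j)) (K / (1 + x\<^sup>2))) \<longlonglongrightarrow> 0"
    proof (intro AE_I2)
      fix x :: real
      have "(\<lambda>j. min (1 / real (Suc j)) (K / (1 + x\<^sup>2))) \<longlonglongrightarrow> min 0 (K / (1 + x\<^sup>2))"
        by (intro tendsto_min LIMSEQ_Suc[OF lim_1_over_n] tendsto_const)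
      then show "(\<lambda>j. min (1 / real (Suc j)) (K / (1 + x\<^sup>2))) \<longlonglongrightarrow> 0"
        using assms by (simp add: min_def add_nonneg_nonneg)
    qed
  qed auto
  then show ?thesis by simp
qed

lemma grid_integral_min_decay:
  assumes n: "n > 0" and K: "K \<ge> 0" and c: "c > 0"
  shows "grid_integral n (\<lambda>x. min c (K / (1 + x\<^sup>2))) \<le> (LINT x|lborel. min c (3 * K / (1 + x\<^sup>2)))"
proof -
  let ?f = "\<lambda>x. indicator {- real n ..< real n} x *\<^sub>R min c (K / (1 + (grid_point n x)\<^sup>2))"
  have hb: "has_bochner_integral lborel ?f (grid_integral n (\<lambda>x. min c (K / (1 + x\<^sup>2))))"
    using has_bochner_integral_grid[of n "\<lambda>x. min c (K / (1 + x\<^sup>2))"] .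
  have w: "integrable lborel (\<lambda>x. 3 * K / (1 + x\<^sup>2))"
    using has_bochner_integral_decay by (simp add: has_bochner_integral_iff)
  have "integral\<^sup>L lborel ?f \<le> (LINT x|lborel. min c (3 * K / (1 + x\<^sup>2)))"
  proof (rule integral_mono)
    show "integrable lborel ?f" using hb by (simp add: has_bochner_integral_iff)
    show "integrable lborel (\<lambda>x. min c (3 * K / (1 + x\<^sup>2)))"
      using K c by (intro Bochner_Integration.integrable_bound[OF w])
        (auto simp: min_def abs_if add_nonneg_nonneg)
    fix x :: real
    have "norm (K / (1 + (grid_point n x)\<^sup>2)) \<le> 3 * K / (1 + x\<^sup>2)"
      using n K by (intro decay_grid) (auto simp: add_nonneg_nonneg)
    then have *: "K / (1 + (grid_point n x)\<^sup>2) \<le> 3 * K / (1 + x\<^sup>2)" using K by simp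
    have "0 \<le> min c (3 * K / (1 + x\<^sup>2))" using K c by (simp add: add_nonneg_nonneg)
    moreover have "min c (K / (1 + (grid_point n x)\<^sup>2)) \<le> min c (3 * K / (1 + x\<^sup>2))"
      by (rule min.mono[OF order_refl *])
    ultimately show "?f x \<le> min c (3 * K / (1 + x\<^sup>2))"
      by (simp only: indicator_def scaleR_one scaleR_zero_left of_bool_def split: if_split) simp
  qed
  then show ?thesis using has_bochner_integral_integral_eq[OF hb] by simp
qed

section \<open>The Loeb measure\<close>

text \<open>Transfers of set operations keep the result internal; their agreement with the
  operations on \<open>elems\<close> is what makes the internal grid sets an algebra.\<close>

definition hyper_Un :: "'h extension \<Rightarrow> 'h \<Rightarrow> 'h \<Rightarrow> 'h" where
  "hyper_Un N A B = ap N {[St C, St D, St (C \<union> D)] |C D. True} [A, B]"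

definition hyper_Compl :: "'h extension \<Rightarrow> 'h \<Rightarrow> 'h \<Rightarrow> 'h" where
  "hyper_Compl N \<eta> A = ap N {[Rl (real n), St B, St ({- real n ..< real n} - B)] |n B. True} [\<eta>, A]"

definition hyper_interval :: "'h extension \<Rightarrow> 'h \<Rightarrow> real \<Rightarrow> real \<Rightarrow> 'h" where
  "hyper_interval N \<eta> a b = ap N {[Rl (real n), St (grid_interval n a b)] |n. True} [\<eta>]"

lemma (in germ) hyper_Un_ev:
  "hyper_Un N (ev (\<lambda>i. St (a i))) (ev (\<lambda>i. St (b i))) = ev (\<lambda>i. St (a i \<union> b i))"
  unfolding hyper_Un_def
  using ap_ev[of "[\<lambda>i. St (a i), \<lambda>i. St (b i)]" _ "\<lambda>i. St (a i \<union> b i)"] by simp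

context hypergrid
begin

lemma hyper_Compl_ev:
  "hyper_Compl N \<eta> (ev (\<lambda>i. St (a i))) = ev (\<lambda>i. St ({- real (\<nu> i) ..< real (\<nu> i)} - a i))"
  unfolding hyper_Compl_def \<eta>
  using ap_ev[of "[\<lambda>i. Rl (real (\<nu> i)), \<lambda>i. St (a i)]" _ "\<lambda>i. St ({- real (\<nu> i) ..< real (\<nu> i)} - a i)"]
  by simp

lemma hyper_interval_ev: "hyper_interval N \<eta> a b = ev (\<lambda>i. St (grid_interval (\<nu> i) a b))"
  unfolding hyper_interval_def \<eta>
  using ap_ev[of "[\<lambda>i. Rl (real (\<nu> i))]" _ "\<lambda>i. St (grid_interval (\<nu> i) a b)"] by simp

end

section \<open>The algebra of internal grid sets and its Loeb content\<close>

context infinite_grid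
begin

lemma hypergrid_exists_set:
  assumes "hyperset N A"
  obtains T :: "(nat \<times> real set \<times> real set \<times> real) filter" and ev \<nu> a
  where "hypergrid N T ev \<eta> \<nu>" "A = ev (\<lambda>i. St (a i))"
  using hypergrid_exists[OF assms hyperset_emb hyperreal_emb] by metis

lemma hypergrid_exists_sets:
  assumes "hyperset N A" "hyperset N B"
  obtains T :: "(nat \<times> real set \<times> real set \<times> real) filter" and ev \<nu> a b
  where "hypergrid N T ev \<eta> \<nu>" "A = ev (\<lambda>i. St (a i))" "B = ev (\<lambda>i. St (b i))"
  using hypergrid_exists[OF assms hyperreal_emb] by metis

lemma elems_subset_Rbar:
  assumes "A \<in> grid_sets N \<eta>"
  shows "elems N A \<subseteq> elems N (Rbar N \<eta>)"
proof
  fix t assume t: "t \<in> elems N A"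
  obtain T :: "(nat \<times> real set \<times> real set \<times> real) filter" and ev \<nu> a b \<tau>
    where h: "hypergrid N T ev \<eta> \<nu>" "A = ev (\<lambda>i. St (a i))" "A = ev (\<lambda>i. St (b i))" "t = ev (\<lambda>i. Rl (\<tau> i))"
    by (rule hypergrid_exists[OF hyperset_grid_sets[OF assms] hyperset_grid_sets[OF assms] hyperreal_elems[OF t]])
  interpret hypergrid N T ev \<eta> \<nu> by fact
  have "\<forall>\<^sub>F i in T. a i \<in> grid_algebra (\<nu> i)" "\<forall>\<^sub>F i in T. \<tau> i \<in> a i"
    using assms t unfolding h(2,4) grid_sets_ev elems_ev .
  then have "\<forall>\<^sub>F i in T. \<tau> i \<in> {- real (\<nu> i) ..< real (\<nu> i)}"
    using eventually_\<nu>[of 0] by eventually_elim (use grid_algebra_subset in blast)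
  then show "t \<in> elems N (Rbar N \<eta>)" unfolding Rbar_ev h(4) elems_ev .
qed

lemma elems_hyper_Un:
  assumes "hyperset N A" "hyperset N B"
  shows "elems N (hyper_Un N A B) = elems N A \<union> elems N B"
proof -
  have "t \<in> elems N (hyper_Un N A B) \<longleftrightarrow> t \<in> elems N A \<union> elems N B" if t: "hyperreal N t" for t
  proof -
    obtain T :: "(nat \<times> real set \<times> real set \<times> real) filter" and ev \<nu> a b \<tau>
      where h: "hypergrid N T ev \<eta> \<nu>" "A = ev (\<lambda>i. St (a i))" "B = ev (\<lambda>i. St (b i))" "t = ev (\<lambda>i. Rl (\<tau> i))"
      by (rule hypergrid_exists[OF assms t])
    interpret hypergrid N T ev \<eta> \<nu> by fact
    show ?thesis unfolding h(2-4) hyper_Un_ev Un_iff elems_ev by (rule eventually_disj_iff)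
  qed
  then show ?thesis using hyperreal_elems by blast
qed

lemma elems_hyper_Compl:
  assumes "hyperset N A"
  shows "elems N (hyper_Compl N \<eta> A) = elems N (Rbar N \<eta>) - elems N A"
proof -
  have "t \<in> elems N (hyper_Compl N \<eta> A) \<longleftrightarrow> t \<in> elems N (Rbar N \<eta>) - elems N A" if t: "hyperreal N t" for t
  proof -
    obtain T :: "(nat \<times> real set \<times> real set \<times> real) filter" and ev \<nu> a b \<tau>
      where h: "hypergrid N T ev \<eta> \<nu>" "A = ev (\<lambda>i. St (a i))" "A = ev (\<lambda>i. St (b i))" "t = ev (\<lambda>i. Rl (\<tau> i))"
      by (rule hypergrid_exists[OF assms assms t])
    interpret hypergrid N T ev \<eta> \<nu> by fact
    show ?thesis
      unfolding h(2,4) hyper_Compl_ev Rbar_ev Diff_iff elems_ev eventually_conj_iff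
      by (simp only: eventually_not_iff)
  qed
  then show ?thesis using hyperreal_elems by blast
qed

lemma grid_sets_hyper_Un:
  assumes "A \<in> grid_sets N \<eta>" "B \<in> grid_sets N \<eta>"
  shows "hyper_Un N A B \<in> grid_sets N \<eta>"
proof -
  obtain T :: "(nat \<times> real set \<times> real set \<times> real) filter" and ev \<nu> a b
    where h: "hypergrid N T ev \<eta> \<nu>" "A = ev (\<lambda>i. St (a i))" "B = ev (\<lambda>i. St (b i))"
    by (rule hypergrid_exists_sets[OF assms[THEN hyperset_grid_sets]])
  interpret hypergrid N T ev \<eta> \<nu> by fact
  have "\<forall>\<^sub>F i in T. a i \<in> grid_algebra (\<nu> i)" "\<forall>\<^sub>F i in T. b i \<in> grid_algebra (\<nu> i)"
    using assms unfolding h(2,3) grid_sets_ev .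
  then show ?thesis
    unfolding h(2,3) hyper_Un_ev grid_sets_ev
    using eventually_\<nu>[of 0] by eventually_elim (rule grid_algebra_Un)
qed

lemma grid_sets_hyper_Compl:
  assumes "A \<in> grid_sets N \<eta>"
  shows "hyper_Compl N \<eta> A \<in> grid_sets N \<eta>"
proof -
  obtain T :: "(nat \<times> real set \<times> real set \<times> real) filter" and ev \<nu> a
    where h: "hypergrid N T ev \<eta> \<nu>" "A = ev (\<lambda>i. St (a i))"
    by (rule hypergrid_exists_set[OF assms[THEN hyperset_grid_sets]])
  interpret hypergrid N T ev \<eta> \<nu> by fact
  have "\<forall>\<^sub>F i in T. a i \<in> grid_algebra (\<nu> i)"
    using assms unfolding h(2) grid_sets_ev .
  then show ?thesis
    unfolding h(2) hyper_Compl_ev grid_sets_ev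
    using eventually_\<nu>[of 0] by eventually_elim (rule grid_algebra_Diff)
qed

lemma grid_sets_hyper_interval: "hyper_interval N \<eta> a b \<in> grid_sets N \<eta>"
proof -
  obtain T :: "(nat \<times> real set \<times> real set \<times> real) filter" and ev \<nu> \<tau>
    where h: "hypergrid N T ev \<eta> \<nu>" "emb N (Rl 0) = ev (\<lambda>i. Rl (\<tau> i))"
    by (rule hypergrid_exists_point[OF hyperreal_emb])
  interpret hypergrid N T ev \<eta> \<nu> by fact
  show ?thesis unfolding hyper_interval_ev grid_sets_ev
    using eventually_\<nu>[of 0] by eventually_elim (rule grid_interval_in_grid_algebra)
qed

text \<open>Extensionality of internal sets, which makes the definite description in
  \<open>loeb_content\<close> meaningful. If two families of sets differ on a large set of indices,
  choosing a point of the difference at each index yields a hyperreal in exactly one of the two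
  internal sets.\<close>

lemma elems_inject:
  assumes "hyperset N A" "hyperset N B" and eq: "elems N A = elems N B"
  shows "A = B"
proof (rule ccontr)
  assume "A \<noteq> B"
  obtain T :: "(nat \<times> real set \<times> real set \<times> real) filter" and ev \<nu> a b
    where h: "hypergrid N T ev \<eta> \<nu>" "A = ev (\<lambda>i. St (a i))" "B = ev (\<lambda>i. St (b i))"
    by (rule hypergrid_exists_sets[OF assms(1,2)])
  interpret hypergrid N T ev \<eta> \<nu> by fact
  define \<tau> where "\<tau> i = (SOME x. (x \<in> a i) \<noteq> (x \<in> b i))" for i
  have "\<not> (\<forall>\<^sub>F i in T. a i = b i)" using \<open>A \<noteq> B\<close> unfolding h(2,3) ev_eq_iff by simp
  then have "\<forall>\<^sub>F i in T. a i \<noteq> b i" by (rule ultra)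
  then have "\<forall>\<^sub>F i in T. (\<tau> i \<in> a i) \<noteq> (\<tau> i \<in> b i)"
  proof eventually_elim
    case (elim i)
    then have "\<exists>x. (x \<in> a i) \<noteq> (x \<in> b i)" by blast
    then show ?case unfolding \<tau>_def by (rule someI_ex)
  qed
  moreover have "ev (\<lambda>i. Rl (\<tau> i)) \<in> elems N A \<longleftrightarrow> ev (\<lambda>i. Rl (\<tau> i)) \<in> elems N B" using eq by simp
  then have "(\<forall>\<^sub>F i in T. \<tau> i \<in> a i) \<longleftrightarrow> (\<forall>\<^sub>F i in T. \<tau> i \<in> b i)"
    unfolding h(2,3) elems_ev .
  then have "(\<forall>\<^sub>F i in T. \<tau> i \<in> a i \<and> \<tau> i \<in> b i) \<or> (\<forall>\<^sub>F i in T. \<tau> i \<notin> a i \<and> \<tau> i \<notin> b i)"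
    by (auto simp: eventually_conj_iff eventually_not_iff)
  then have "\<forall>\<^sub>F i in T. (\<tau> i \<in> a i) = (\<tau> i \<in> b i)" by (auto elim: eventually_mono)
  ultimately show False using eventually_not_iff[of "\<lambda>i. (\<tau> i \<in> a i) = (\<tau> i \<in> b i)"] by blast
qed

lemma loeb_content_elems:
  assumes "A \<in> grid_sets N \<eta>"
  shows "loeb_content N \<eta> (elems N A) =
    (if hfinite N (lam N \<eta> A) then ennreal (std_part N (lam N \<eta> A)) else \<infinity>)"
proof -
  have "(THE B. B \<in> grid_sets N \<eta> \<and> elems N B = elems N A) = A"
    using assms elems_inject hyperset_grid_sets by (intro the_equality) auto
  then show ?thesis by (simp add: loeb_content_def Let_def)
qed

text \<open>In \<open>ennreal\<close> the finite and the infinite value are both limits of the grid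
  measures, so additivity follows from continuity of addition without case distinctions.\<close>

lemma tendsto_loeb_content:
  assumes "hypergrid N T ev \<eta> \<nu>" "ev (\<lambda>i. St (a i)) \<in> grid_sets N \<eta>"
  shows "((\<lambda>i. ennreal (grid_measure (\<nu> i) (a i))) \<longlongrightarrow> loeb_content N \<eta> (elems N (ev (\<lambda>i. St (a i))))) T"
proof -
  interpret hypergrid N T ev \<eta> \<nu> by fact
  let ?f = "\<lambda>i. grid_measure (\<nu> i) (a i)"
  show ?thesis
  proof (cases "hfinite N (ev (\<lambda>i. Rl (?f i)))")
    case True
    then obtain l where l: "(?f \<longlongrightarrow> l) T" unfolding hfinite_iff_convergent ..
    have "loeb_content N \<eta> (elems N (ev (\<lambda>i. St (a i)))) = ennreal l"
      using True unfolding loeb_content_elems[OF assms(2)] lam_ev std_part_ev[OF l] by simp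
    then show ?thesis using tendsto_ennrealI[OF l] by simp
  next
    case False
    then have "\<not> (\<forall>\<^sub>F i in T. \<bar>?f i\<bar> \<le> r)" for r unfolding hfinite_ev by blast
    then have "\<forall>\<^sub>F i in T. \<not> \<bar>?f i\<bar> \<le> r" for r by (rule ultra)
    then have "\<forall>\<^sub>F i in T. r \<le> ?f i" for r
      by (rule eventually_mono[of "\<lambda>i. \<not> \<bar>?f i\<bar> \<le> r"]) (simp add: grid_measure_nonneg)
    then have "filterlim ?f at_top T" by (simp add: filterlim_at_top)
    then have "((\<lambda>i. ennreal (?f i)) \<longlongrightarrow> top) T" by (simp only: ennreal_tendsto_top_eq_at_top)
    moreover have "loeb_content N \<eta> (elems N (ev (\<lambda>i. St (a i)))) = top"
      using False unfolding loeb_content_elems[OF assms(2)] lam_ev by simp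
    ultimately show ?thesis by simp
  qed
qed

lemma loeb_content_Un:
  assumes AB: "A \<in> grid_sets N \<eta>" "B \<in> grid_sets N \<eta>" and disj: "elems N A \<inter> elems N B = {}"
  shows "loeb_content N \<eta> (elems N A \<union> elems N B) = loeb_content N \<eta> (elems N A) + loeb_content N \<eta> (elems N B)"
proof -
  obtain T :: "(nat \<times> real set \<times> real set \<times> real) filter" and ev \<nu> a b
    where h: "hypergrid N T ev \<eta> \<nu>" "A = ev (\<lambda>i. St (a i))" "B = ev (\<lambda>i. St (b i))"
    by (rule hypergrid_exists_sets[OF AB[THEN hyperset_grid_sets]])
  interpret hypergrid N T ev \<eta> \<nu> by fact
  have alg: "\<forall>\<^sub>F i in T. a i \<in> grid_algebra (\<nu> i)" "\<forall>\<^sub>F i in T. b i \<in> grid_algebra (\<nu> i)"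
    using AB unfolding h(2,3) grid_sets_ev .
  \<comment> \<open>Disjointness is known only for hyperreal elements. Were the standard sets to
    meet on a large set of indices, the chosen common points would form a common element.\<close>
  have "\<forall>\<^sub>F i in T. a i \<inter> b i = {}"
  proof (rule ccontr)
    assume "\<not> (\<forall>\<^sub>F i in T. a i \<inter> b i = {})"
    then have "\<forall>\<^sub>F i in T. a i \<inter> b i \<noteq> {}" by (rule ultra)
    then have "\<forall>\<^sub>F i in T. (SOME x. x \<in> a i \<inter> b i) \<in> a i \<inter> b i"
      by eventually_elim (simp only: some_in_eq not_False_eq_True)
    then have "ev (\<lambda>i. Rl (SOME x. x \<in> a i \<inter> b i)) \<in> elems N A \<inter> elems N B"
      unfolding h(2,3) Int_iff elems_ev by (simp add: eventually_conj_iff)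
    with disj show False by blast
  qed
  with alg have sum: "\<forall>\<^sub>F i in T. ennreal (grid_measure (\<nu> i) (a i)) + ennreal (grid_measure (\<nu> i) (b i)) =
      ennreal (grid_measure (\<nu> i) (a i \<union> b i))"
    using eventually_\<nu>[of 0]
    by eventually_elim (simp add: grid_measure_additive grid_measure_nonneg)
  have A: "((\<lambda>i. ennreal (grid_measure (\<nu> i) (a i))) \<longlongrightarrow> loeb_content N \<eta> (elems N A)) T"
    using AB(1) unfolding h(2) by (rule tendsto_loeb_content[OF h(1)])
  have B: "((\<lambda>i. ennreal (grid_measure (\<nu> i) (b i))) \<longlongrightarrow> loeb_content N \<eta> (elems N B)) T"
    using AB(2) unfolding h(3) by (rule tendsto_loeb_content[OF h(1)])
  have "((\<lambda>i. ennreal (grid_measure (\<nu> i) (a i \<union> b i))) \<longlongrightarrow> loeb_content N \<eta> (elems N (hyper_Un N A B))) T"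
    using grid_sets_hyper_Un[OF AB] unfolding h(2,3) hyper_Un_ev by (rule tendsto_loeb_content[OF h(1)])
  moreover have "((\<lambda>i. ennreal (grid_measure (\<nu> i) (a i \<union> b i))) \<longlongrightarrow>
      loeb_content N \<eta> (elems N A) + loeb_content N \<eta> (elems N B)) T"
    using tendsto_add[OF A B] sum by (rule Lim_transform_eventually)
  ultimately have "loeb_content N \<eta> (elems N (hyper_Un N A B)) =
      loeb_content N \<eta> (elems N A) + loeb_content N \<eta> (elems N B)"
    by (rule tendsto_unique[OF nontrivial])
  then show ?thesis unfolding elems_hyper_Un[OF AB[THEN hyperset_grid_sets]] .
qed

lemma loeb_content_interval:
  assumes "a \<le> b"
  shows "loeb_content N \<eta> (elems N (hyper_interval N \<eta> a b)) = ennreal (b - a)"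
proof -
  obtain T :: "(nat \<times> real set \<times> real set \<times> real) filter" and ev \<nu> \<tau>
    where h: "hypergrid N T ev \<eta> \<nu>" "emb N (Rl 0) = ev (\<lambda>i. Rl (\<tau> i))"
    by (rule hypergrid_exists_point[OF hyperreal_emb])
  interpret hypergrid N T ev \<eta> \<nu> by fact
  have "((\<lambda>i. ennreal (grid_measure (\<nu> i) (grid_interval (\<nu> i) a b))) \<longlongrightarrow>
      loeb_content N \<eta> (elems N (hyper_interval N \<eta> a b))) T"
    using grid_sets_hyper_interval[of a b] unfolding hyper_interval_ev by (rule tendsto_loeb_content[OF h(1)])
  moreover have "((\<lambda>i. ennreal (grid_measure (\<nu> i) (grid_interval (\<nu> i) a b))) \<longlongrightarrow> ennreal (b - a)) T"
    using filterlim_compose[OF tendsto_grid_measure_interval[OF assms] \<nu>] by (rule tendsto_ennrealI)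
  ultimately show ?thesis using tendsto_unique[OF nontrivial] by blast
qed

lemma loeb_algebra: "algebra (elems N (Rbar N \<eta>)) (elems N ` grid_sets N \<eta>)"
  unfolding algebra_iff_Un
proof (intro conjI ballI)
  show "elems N ` grid_sets N \<eta> \<subseteq> Pow (elems N (Rbar N \<eta>))" using elems_subset_Rbar by auto
  show compl: "elems N (Rbar N \<eta>) - X \<in> elems N ` grid_sets N \<eta>" if "X \<in> elems N ` grid_sets N \<eta>" for X
    using that grid_sets_hyper_Compl elems_hyper_Compl[OF hyperset_grid_sets, symmetric] by auto
  show un: "X \<union> Y \<in> elems N ` grid_sets N \<eta>" if "X \<in> elems N ` grid_sets N \<eta>" "Y \<in> elems N ` grid_sets N \<eta>" for X Y
    using that grid_sets_hyper_Un elems_hyper_Un[OF hyperset_grid_sets hyperset_grid_sets, symmetric] by auto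
  \<comment> \<open>Any member of the algebra would serve: the empty set is the complement of the
    union of a member with its complement.\<close>
  let ?J = "elems N (hyper_interval N \<eta> 0 0)"
  have "?J \<in> elems N ` grid_sets N \<eta>" using grid_sets_hyper_interval by blast
  then have "elems N (Rbar N \<eta>) - (?J \<union> (elems N (Rbar N \<eta>) - ?J)) \<in> elems N ` grid_sets N \<eta>"
    by (intro compl un)
  moreover have "elems N (Rbar N \<eta>) - (?J \<union> (elems N (Rbar N \<eta>) - ?J)) = {}" by blast
  ultimately show "{} \<in> elems N ` grid_sets N \<eta>" by (simp only:)
qed

end

sublocale infinite_grid \<subseteq> loeb: algebra "elems N (Rbar N \<eta>)" "elems N ` grid_sets N \<eta>"
  by (rule loeb_algebra)

text \<open>The Loeb measure is given by the outer measure itself, so the existence of some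
  extension is not enough: the generated sigma-algebra lies inside the Caratheodory measurable sets,
  and the outer measure is restricted to it.\<close>

lemma (in ring_of_sets) measure_space_outer_measure:
  assumes pos: "positive M f" and ca: "countably_additive M f"
  shows "measure_space \<Omega> (sigma_sets \<Omega> M) (outer_measure M f)"
proof -
  have add: "additive M f" by (rule countably_additive_additive[OF pos ca])
  have inc: "increasing M f" using pos add by (rule additive_increasing)
  have ls: "measure_space \<Omega> (lambda_system \<Omega> (Pow \<Omega>) (outer_measure M f)) (outer_measure M f)"
    using sigma_algebra.caratheodory_lemma[OF sigma_algebra_Pow outer_measure_space_outer_measure[OF pos inc]] .
  have "sigma_sets \<Omega> M \<subseteq> lambda_system \<Omega> (Pow \<Omega>) (outer_measure M f)"
    using ls algebra_subset_lambda_system[OF pos inc add]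
    by (intro sigma_algebra.sigma_sets_subset) (simp_all add: measure_space_def)
  then show ?thesis
    using measure_down[OF ls sigma_algebra_sigma_sets[OF space_closed]] by blast
qed

section \<open>Countable additivity from saturation\<close>

locale saturated_grid = infinite_grid +
  assumes saturated: "countably_saturated N"
begin

lemma positive_loeb_content: "positive (elems N ` grid_sets N \<eta>) (loeb_content N \<eta>)"
proof -
  have "elems N (hyper_interval N \<eta> 0 0) = {}"
  proof (rule equals0I)
    fix t assume t: "t \<in> elems N (hyper_interval N \<eta> 0 0)"
    obtain T :: "(nat \<times> real set \<times> real set \<times> real) filter" and ev \<nu> \<tau>
      where h: "hypergrid N T ev \<eta> \<nu>" "t = ev (\<lambda>i. Rl (\<tau> i))"
      by (rule hypergrid_exists_point[OF hyperreal_elems[OF t]])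
    interpret hypergrid N T ev \<eta> \<nu> by fact
    have "\<forall>\<^sub>F i in T. \<tau> i \<in> grid_interval (\<nu> i) 0 0"
      using t unfolding h(2) hyper_interval_ev elems_ev .
    then have "\<forall>\<^sub>F i in T. False" by eventually_elim (auto simp: grid_interval_def)
    then show False using nontrivial by (simp add: eventually_False)
  qed
  then show ?thesis using loeb_content_interval[of 0 0] by (simp add: positive_def)
qed

lemma additive_loeb_content: "additive (elems N ` grid_sets N \<eta>) (loeb_content N \<eta>)"
  unfolding additive_def using loeb_content_Un by blast

text \<open>If no finite subfamily covers, any finitely many of the conditions of lying in
  \<open>A\<close> but outside \<open>B i\<close> have a common solution. Saturation then provides a
  point of \<open>A\<close> outside every \<open>B i\<close>.\<close>

lemma countable_cover_finite:
  assumes A: "hyperset N A" and B: "\<And>i::nat. hyperset N (B i)"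
    and cover: "elems N A \<subseteq> (\<Union>i. elems N (B i))"
  shows "\<exists>n. elems N A \<subseteq> (\<Union>i<n. elems N (B i))"
proof (rule ccontr)
  assume "\<not> ?thesis"
  then have ex: "\<exists>y. y \<in> elems N A \<and> (\<forall>i<n. y \<notin> elems N (B i))" for n by blast
  define R where "R = {[Rl r, St C, St D] |r C D. r \<in> C \<and> r \<notin> D}"
  have R: "y # [A, B i] \<in> star N R \<longleftrightarrow> y \<in> elems N A \<and> y \<notin> elems N (B i)" for y i
  proof -
    have "hyperreal N y" if "[y, A, B i] \<in> star N R"
      using that star_reindex[of "[0]" "[y, A, B i]" "{[Rl r] |r. True}"]
      unfolding hyperreal_def R_def by (auto elim: star_mono)
    moreover have "[y, A, B i] \<in> star N R \<longleftrightarrow> y \<in> elems N A \<and> y \<notin> elems N (B i)" if y: "hyperreal N y"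
    proof -
      obtain T :: "(nat \<times> real set \<times> real set \<times> real) filter" and ev \<nu> a b \<tau>
        where h: "hypergrid N T ev \<eta> \<nu>" "A = ev (\<lambda>i. St (a i))" "B i = ev (\<lambda>i. St (b i))" "y = ev (\<lambda>i. Rl (\<tau> i))"
        by (rule hypergrid_exists[OF A B y])
      interpret hypergrid N T ev \<eta> \<nu> by fact
      show ?thesis
        unfolding h(2-4) los3 elems_ev eventually_not_iff[symmetric] eventually_conj_iff[symmetric]
        by (simp add: R_def)
    qed
    ultimately show ?thesis using hyperreal_elems by auto
  qed
  have "\<exists>y. \<forall>i. y # [A, B i] \<in> star N R"
    using saturated[unfolded countably_saturated_def, rule_format, of "\<lambda>i. [A, B i]" "\<lambda>_. R"] ex
    unfolding R by blast
  then show False using cover unfolding R by blast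
qed

text \<open>A countable disjoint union that is again internal has a finite subcover, so all but
  finitely many members are empty, and finite additivity is enough.\<close>

lemma countably_additive_loeb_content:
  "countably_additive (elems N ` grid_sets N \<eta>) (loeb_content N \<eta>)"
proof (rule countably_additiveI)
  fix X :: "nat \<Rightarrow> 'a set"
  assume X: "range X \<subseteq> elems N ` grid_sets N \<eta>" "disjoint_family X" "(\<Union>i. X i) \<in> elems N ` grid_sets N \<eta>"
  from X(1) have "\<forall>i. \<exists>B. B \<in> grid_sets N \<eta> \<and> X i = elems N B" by blast
  then obtain B where B: "\<And>i. B i \<in> grid_sets N \<eta>" "\<And>i. X i = elems N (B i)" by metis
  from X(3) obtain A where A: "A \<in> grid_sets N \<eta>" "(\<Union>i. X i) = elems N A" by blast
  obtain n where n: "elems N A \<subseteq> (\<Union>i<n. X i)"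
    using countable_cover_finite[of A B] A B hyperset_grid_sets by auto
  then have un: "(\<Union>i<n. X i) = (\<Union>i. X i)" using A(2) by blast
  have empty: "X i = {}" if "i \<notin> {..<n}" for i
  proof -
    have "X i \<inter> X j = {}" if "j < n" for j
      using \<open>i \<notin> {..<n}\<close> that X(2) by (auto simp: disjoint_family_on_def)
    moreover have "X i \<subseteq> (\<Union>j<n. X j)" using un by blast
    ultimately show ?thesis by blast
  qed
  have "(\<Sum>i. loeb_content N \<eta> (X i)) = (\<Sum>i\<in>{..<n}. loeb_content N \<eta> (X i))"
    using positive_loeb_content by (intro suminf_finite) (auto simp: empty positive_def)
  also have "\<dots> = loeb_content N \<eta> (\<Union>i\<in>{..<n}. X i)"
    using X(1,2) by (intro loeb.additive_sum positive_loeb_content additive_loeb_content)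
      (auto simp: disjoint_family_on_def)
  finally show "(\<Sum>i. loeb_content N \<eta> (X i)) = loeb_content N \<eta> (\<Union>i. X i)" using un by simp
qed

text \<open>The Loeb measure before completion; the standard part map is shown to be measurable at
  this stage.\<close>

definition loeb0 :: "'a measure" where
  "loeb0 = measure_of (elems N (Rbar N \<eta>)) (elems N ` grid_sets N \<eta>)
     (outer_measure (elems N ` grid_sets N \<eta>) (loeb_content N \<eta>))"

lemma loeb_eq_completion: "loeb N \<eta> = completion loeb0"
  by (simp add: loeb_def loeb0_def Let_def)

lemma space_loeb0 [simp]: "space loeb0 = elems N (Rbar N \<eta>)"
  unfolding loeb0_def using loeb.space_closed by (rule space_measure_of)

lemma sets_loeb0: "sets loeb0 = sigma_sets (elems N (Rbar N \<eta>)) (elems N ` grid_sets N \<eta>)"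
  unfolding loeb0_def using loeb.space_closed by (rule sets_measure_of)

lemma elems_in_sets_loeb0 [simp]: "A \<in> grid_sets N \<eta> \<Longrightarrow> elems N A \<in> sets loeb0"
  unfolding sets_loeb0 by (intro sigma_sets.Basic imageI)

lemma emeasure_loeb0:
  assumes "A \<in> grid_sets N \<eta>"
  shows "emeasure loeb0 (elems N A) = loeb_content N \<eta> (elems N A)"
proof -
  have "measure_space (elems N (Rbar N \<eta>)) (sets loeb0) (outer_measure (elems N ` grid_sets N \<eta>) (loeb_content N \<eta>))"
    unfolding sets_loeb0
    by (rule loeb.measure_space_outer_measure[OF positive_loeb_content countably_additive_loeb_content])
  then have "emeasure loeb0 (elems N A) = outer_measure (elems N ` grid_sets N \<eta>) (loeb_content N \<eta>) (elems N A)"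
    using assms by (intro emeasure_measure_of[OF loeb0_def loeb.space_closed])
      (auto simp: measure_space_def)
  also have "\<dots> = loeb_content N \<eta> (elems N A)"
    using assms by (intro loeb.outer_measure_agrees positive_loeb_content countably_additive_loeb_content) auto
  finally show ?thesis .
qed

end



section \<open>The standard part map\<close>

context infinite_grid
begin

text \<open>Rounding changes a point by an infinitesimal, and the strict upper bound weakens in the
  limit: a point infinitely close to \<open>b\<close> from below has standard part
  \<open>b\<close>.\<close>

lemma interval_elems:
  assumes "t \<in> elems N (hyper_interval N \<eta> a b)"
  shows "hfinite N t" "a \<le> std_part N t" "std_part N t \<le> b"
proof -
  obtain T :: "(nat \<times> real set \<times> real set \<times> real) filter" and ev \<nu> \<tau>
    where h: "hypergrid N T ev \<eta> \<nu>" "t = ev (\<lambda>i. Rl (\<tau> i))"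
    by (rule hypergrid_exists_point[OF hyperreal_elems[OF assms]])
  interpret hypergrid N T ev \<eta> \<nu> by fact
  have mem: "\<forall>\<^sub>F i in T. \<tau> i \<in> grid_interval (\<nu> i) a b"
    using assms unfolding h(2) hyper_interval_ev elems_ev .
  then have "\<forall>\<^sub>F i in T. \<bar>\<tau> i\<bar> \<le> \<bar>a\<bar> + \<bar>b\<bar> + 1"
    using eventually_\<nu>[of 0]
  proof eventually_elim
    case (elim i)
    have "1 / real (\<nu> i) \<le> 1" using elim by simp
    moreover have "a \<le> grid_point (\<nu> i) (\<tau> i)" "grid_point (\<nu> i) (\<tau> i) < b"
      using elim by (simp_all add: grid_interval_def)
    ultimately show ?case using grid_point_bounds[OF elim(2), of "\<tau> i"] by linarith
  qed
  then show fin: "hfinite N t" unfolding h(2) hfinite_ev by blast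
  then obtain l where l: "(\<tau> \<longlongrightarrow> l) T" unfolding h(2) hfinite_iff_convergent ..
  have gp: "((\<lambda>i. grid_point (\<nu> i) (\<tau> i)) \<longlongrightarrow> l) T" by (rule tendsto_grid_point[OF \<nu> l])
  have "a \<le> l"
    using mem by (intro tendsto_lowerbound[OF gp _ nontrivial]) (auto simp: grid_interval_def elim: eventually_mono)
  moreover have "l \<le> b"
    using mem by (intro tendsto_upperbound[OF gp _ nontrivial]) (auto simp: grid_interval_def elim: eventually_mono)
  ultimately show "a \<le> std_part N t" "std_part N t \<le> b" unfolding h(2) std_part_ev[OF l] .
qed

text \<open>A limit strictly between \<open>a\<close> and \<open>b\<close> forces the rounded points
  there eventually. The gap between these strict bounds and the weak ones of
  \<open>interval_elems\<close> is bridged below by shrinking margins.\<close>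

lemma interval_elemsI:
  assumes "t \<in> elems N (Rbar N \<eta>)" "hfinite N t" "a < std_part N t" "std_part N t < b"
  shows "t \<in> elems N (hyper_interval N \<eta> a b)"
proof -
  obtain T :: "(nat \<times> real set \<times> real set \<times> real) filter" and ev \<nu> \<tau>
    where h: "hypergrid N T ev \<eta> \<nu>" "t = ev (\<lambda>i. Rl (\<tau> i))"
    by (rule hypergrid_exists_point[OF hyperreal_elems[OF assms(1)]])
  interpret hypergrid N T ev \<eta> \<nu> by fact
  obtain l where l: "(\<tau> \<longlongrightarrow> l) T" using assms(2) unfolding h(2) hfinite_iff_convergent ..
  have gp: "((\<lambda>i. grid_point (\<nu> i) (\<tau> i)) \<longlongrightarrow> l) T" by (rule tendsto_grid_point[OF \<nu> l])
  have ab: "a < l" "l < b" using assms(3,4) unfolding h(2) std_part_ev[OF l] .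
  have "\<forall>\<^sub>F i in T. \<tau> i \<in> {- real (\<nu> i) ..< real (\<nu> i)}" using assms(1) unfolding h(2) Rbar_ev elems_ev .
  with order_tendstoD(1)[OF gp ab(1)] order_tendstoD(2)[OF gp ab(2)]
  have "\<forall>\<^sub>F i in T. \<tau> i \<in> grid_interval (\<nu> i) a b"
    by eventually_elim (simp add: grid_interval_def)
  then show ?thesis unfolding h(2) hyper_interval_ev elems_ev .
qed

lemma elems_interval_mono:
  assumes "a' \<le> a" "b \<le> b'"
  shows "elems N (hyper_interval N \<eta> a b) \<subseteq> elems N (hyper_interval N \<eta> a' b')"
proof
  fix t assume t: "t \<in> elems N (hyper_interval N \<eta> a b)"
  obtain T :: "(nat \<times> real set \<times> real set \<times> real) filter" and ev \<nu> \<tau>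
    where h: "hypergrid N T ev \<eta> \<nu>" "t = ev (\<lambda>i. Rl (\<tau> i))"
    by (rule hypergrid_exists_point[OF hyperreal_elems[OF t]])
  interpret hypergrid N T ev \<eta> \<nu> by fact
  show "t \<in> elems N (hyper_interval N \<eta> a' b')"
    using t assms unfolding h(2) hyper_interval_ev elems_ev
    by (auto simp: grid_interval_def elim: eventually_mono)
qed

definition finite_points :: "'a set" where
  "finite_points = {t \<in> elems N (Rbar N \<eta>). hfinite N t}"

end

context saturated_grid
begin

lemma hyper_interval_in_sets [simp]: "elems N (hyper_interval N \<eta> a b) \<in> sets loeb0"
  by (rule elems_in_sets_loeb0[OF grid_sets_hyper_interval])

lemma hyper_interval_subset: "elems N (hyper_interval N \<eta> a b) \<subseteq> finite_points"
  using elems_subset_Rbar[OF grid_sets_hyper_interval] interval_elems(1) by (auto simp: finite_points_def)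

text \<open>The standard part map is not internal, but the preimage of a half-line is a countable
  union of internal intervals: \<open>m\<close> exhausts the left, and the margin
  \<open>1 / real (Suc k)\<close> turns weak inequality into strict.\<close>

lemma finite_points_Int_less:
  "{t \<in> finite_points. std_part N t < u} =
    (\<Union>k::nat. \<Union>m::nat. elems N (hyper_interval N \<eta> (- real m) (u - 1 / real (Suc k))))"
proof (intro equalityI subsetI)
  fix t assume "t \<in> {t \<in> finite_points. std_part N t < u}"
  then have t: "t \<in> elems N (Rbar N \<eta>)" "hfinite N t" "std_part N t < u" by (auto simp: finite_points_def)
  obtain k where "inverse (real (Suc k)) < u - std_part N t" using reals_Archimedean[of "u - std_part N t"] t(3) by auto
  then have k: "std_part N t < u - 1 / real (Suc k)" by (simp add: inverse_eq_divide)
  obtain m :: nat where "- std_part N t < real m" using reals_Archimedean2 by blast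
  then have "- real m < std_part N t" by simp
  from interval_elemsI[OF t(1,2) this k]
  show "t \<in> (\<Union>k::nat. \<Union>m::nat. elems N (hyper_interval N \<eta> (- real m) (u - 1 / real (Suc k))))" by blast
next
  fix t assume "t \<in> (\<Union>k::nat. \<Union>m::nat. elems N (hyper_interval N \<eta> (- real m) (u - 1 / real (Suc k))))"
  then obtain k m :: nat where t: "t \<in> elems N (hyper_interval N \<eta> (- real m) (u - 1 / real (Suc k)))" by blast
  have "0 < 1 / real (Suc k)" by simp
  then have "std_part N t < u" using interval_elems(3)[OF t] by linarith
  then show "t \<in> {t \<in> finite_points. std_part N t < u}" using hyper_interval_subset t by blast
qed

lemma finite_points_eq: "finite_points = (\<Union>u::nat. {t \<in> finite_points. std_part N t < real u})"
  using reals_Archimedean2 by auto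

lemma finite_points_less_in_sets: "{t \<in> finite_points. std_part N t < u} \<in> sets loeb0"
  unfolding finite_points_Int_less by (intro sets.countable_UN' countableI_type) auto

lemma finite_points_in_sets [simp]: "finite_points \<in> sets loeb0"
  by (subst finite_points_eq, rule sets.countable_UN) (use finite_points_less_in_sets in blast)

lemma finite_points_Int_space: "finite_points \<inter> space loeb0 \<in> sets loeb0"
proof -
  have "finite_points \<inter> space loeb0 = finite_points" by (auto simp: finite_points_def)
  then show ?thesis by (simp only: finite_points_in_sets)
qed

lemma std_part_measurable: "std_part N \<in> borel_measurable (restrict_space loeb0 finite_points)"
  unfolding borel_measurable_iff_less
proof
  fix u
  have "{t \<in> space (restrict_space loeb0 finite_points). std_part N t < u} = {t \<in> finite_points. std_part N t < u}"
    by (auto simp: space_restrict_space finite_points_def)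
  then show "{t \<in> space (restrict_space loeb0 finite_points). std_part N t < u} \<in>
      sets (restrict_space loeb0 finite_points)"
    using finite_points_less_in_sets by (auto simp only: sets_restrict_space_iff[OF finite_points_Int_space])
qed

text \<open>Internal intervals with margins shrinking at both ends increase to the preimage of the
  open interval, and their measures converge to its length.\<close>

lemma emeasure_std_part_interval:
  assumes "l < u"
  shows "emeasure loeb0 {t \<in> finite_points. l < std_part N t \<and> std_part N t < u} = ennreal (u - l)"
proof -
  define J where "J k = elems N (hyper_interval N \<eta> (l + 1 / real (Suc k)) (u - 1 / real (Suc k)))" for k
  have "incseq J"
    unfolding J_def
  proof (intro incseq_SucI elems_interval_mono)
    fix k
    have "1 / real (Suc (Suc k)) \<le> 1 / real (Suc k)" by (intro divide_left_mono) auto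
    then show "l + 1 / real (Suc (Suc k)) \<le> l + 1 / real (Suc k)" "u - 1 / real (Suc k) \<le> u - 1 / real (Suc (Suc k))"
      by linarith+
  qed
  moreover have "range J \<subseteq> sets loeb0" by (auto simp: J_def)
  ultimately have "(\<lambda>k. emeasure loeb0 (J k)) \<longlonglongrightarrow> emeasure loeb0 (\<Union>k. J k)"
    by (intro Lim_emeasure_incseq)
  moreover have "(\<Union>k. J k) = {t \<in> finite_points. l < std_part N t \<and> std_part N t < u}"
  proof (intro equalityI subsetI)
    fix t assume "t \<in> (\<Union>k. J k)"
    then obtain k where t: "t \<in> elems N (hyper_interval N \<eta> (l + 1 / real (Suc k)) (u - 1 / real (Suc k)))"
      by (auto simp: J_def)
    have "0 < 1 / real (Suc k)" by simp
    then have "l < std_part N t" "std_part N t < u" using interval_elems(2,3)[OF t] by linarith+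
    then show "t \<in> {t \<in> finite_points. l < std_part N t \<and> std_part N t < u}"
      using hyper_interval_subset t by blast
  next
    fix t assume t: "t \<in> {t \<in> finite_points. l < std_part N t \<and> std_part N t < u}"
    then have "0 < min (std_part N t - l) (u - std_part N t)" by simp
    then obtain k where "inverse (real (Suc k)) < min (std_part N t - l) (u - std_part N t)"
      using reals_Archimedean by blast
    then have "l + 1 / real (Suc k) < std_part N t" "std_part N t < u - 1 / real (Suc k)"
      unfolding inverse_eq_divide by linarith+
    then have "t \<in> J k" unfolding J_def using t by (intro interval_elemsI) (auto simp: finite_points_def)
    then show "t \<in> (\<Union>k. J k)" by blast
  qed
  moreover have "(\<lambda>k. emeasure loeb0 (J k)) \<longlonglongrightarrow> ennreal (u - l)"
  proof (rule Lim_transform_eventually)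
    have lim0: "(\<lambda>k. 1 / real (Suc k)) \<longlonglongrightarrow> 0" by (rule LIMSEQ_Suc[OF lim_1_over_n])
    have "(\<lambda>k. u - 1 / real (Suc k) - (l + 1 / real (Suc k))) \<longlonglongrightarrow> u - 0 - (l + 0)"
      by (intro tendsto_intros lim0)
    then show "(\<lambda>k. ennreal (u - 1 / real (Suc k) - (l + 1 / real (Suc k)))) \<longlonglongrightarrow> ennreal (u - l)"
      by (intro tendsto_ennrealI) simp
    \<comment> \<open>The length formula needs the endpoints in order, which holds once the margin
      is below half the length.\<close>
    have "0 < (u - l) / 2" using assms by simp
    from order_tendstoD(2)[OF lim0 this]
    show "\<forall>\<^sub>F k in sequentially. ennreal (u - 1 / real (Suc k) - (l + 1 / real (Suc k))) = emeasure loeb0 (J k)"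
    proof eventually_elim
      case (elim k)
      have "l + x \<le> u - x" if "x < (u - l) / 2" for x using that by (simp add: field_simps)
      from this[OF elim] have "l + 1 / real (Suc k) \<le> u - 1 / real (Suc k)" .
      then show ?case
        unfolding J_def emeasure_loeb0[OF grid_sets_hyper_interval] by (simp only: loeb_content_interval)
    qed
  qed
  ultimately show ?thesis using LIMSEQ_unique by metis
qed

lemma distr_std_part: "distr (restrict_space loeb0 finite_points) borel (std_part N) = lborel"
proof (rule lborel_eqI[symmetric])
  fix l u :: real
  assume "\<And>b. b \<in> Basis \<Longrightarrow> l \<bullet> b \<le> u \<bullet> b"
  then have lu: "l \<le> u" by simp
  have "emeasure (distr (restrict_space loeb0 finite_points) borel (std_part N)) (box l u) =
      emeasure (restrict_space loeb0 finite_points)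
        (std_part N -` box l u \<inter> space (restrict_space loeb0 finite_points))"
    by (rule emeasure_distr[OF std_part_measurable]) simp
  also have "std_part N -` box l u \<inter> space (restrict_space loeb0 finite_points) =
      {t \<in> finite_points. l < std_part N t \<and> std_part N t < u}"
    by (auto simp: space_restrict_space finite_points_def box_real)
  also have "emeasure (restrict_space loeb0 finite_points) \<dots> =
      emeasure loeb0 {t \<in> finite_points. l < std_part N t \<and> std_part N t < u}"
    by (rule emeasure_restrict_space[OF finite_points_Int_space]) blast
  also have "\<dots> = ennreal (u - l)"
  proof (cases "l < u")
    case False
    with lu have "{t \<in> finite_points. l < std_part N t \<and> std_part N t < u} = {}" "u - l = 0" by auto
    then show ?thesis by (simp only: emeasure_empty ennreal_0)
  qed (rule emeasure_std_part_interval)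
  finally show "emeasure (distr (restrict_space loeb0 finite_points) borel (std_part N)) (box l u) =
      ennreal (\<Prod>b\<in>Basis. (u - l) \<bullet> b)" by simp
qed simp

lemma has_bochner_integral_loeb:
  fixes f :: "real \<Rightarrow> complex"
  assumes f: "integrable lborel f"
  shows "has_bochner_integral (loeb N \<eta>) (\<lambda>t. extend_zero f (st N t)) (integral\<^sup>L lborel f)"
proof -
  have fm: "f \<in> borel_measurable borel" using f by auto
  have "integrable (restrict_space loeb0 finite_points) (\<lambda>t. f (std_part N t))"
    using f unfolding distr_std_part[symmetric] by (simp add: integrable_distr_eq std_part_measurable fm)
  then have i: "integrable loeb0 (\<lambda>t. indicator finite_points t *\<^sub>R f (std_part N t))"
    by (simp only: integrable_restrict_space[OF finite_points_Int_space])
  have "integral\<^sup>L lborel f = integral\<^sup>L (restrict_space loeb0 finite_points) (\<lambda>t. f (std_part N t))"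
    unfolding distr_std_part[symmetric] by (rule integral_distr[OF std_part_measurable fm])
  also have "\<dots> = integral\<^sup>L loeb0 (\<lambda>t. indicator finite_points t *\<^sub>R f (std_part N t))"
    by (simp only: integral_restrict_space[OF finite_points_Int_space])
  finally have "has_bochner_integral (loeb N \<eta>) (\<lambda>t. indicator finite_points t *\<^sub>R f (std_part N t)) (integral\<^sup>L lborel f)"
    using i unfolding loeb_eq_completion has_bochner_integral_iff
    by (simp add: integrable_completion integral_completion borel_measurable_integrable)
  \<comment> \<open>The value \<open>0\<close> of the extension at both infinities is what
    restriction to the finite points produces.\<close>
  moreover have "indicator finite_points t *\<^sub>R f (std_part N t) = extend_zero f (st N t)"
    if "t \<in> space (loeb N \<eta>)" for t
    using that by (auto simp: loeb_eq_completion finite_points_def extend_zero_def st_def indicator_def)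
  ultimately show ?thesis
    by (subst (asm) has_bochner_integral_cong[OF refl _ refl]) auto
qed

end

text \<open>The conditions quantify over internal sets, and each set brings its own germ; hence the
  hypothesis that one standard sequence \<open>f\<close> represents \<open>F\<close> in all of them.
  Decay bounds the total integral, boundedness by \<open>K\<close> handles sets of infinitesimal
  measure, and integrability of the decay bound handles large sets on which \<open>F\<close> is
  infinitesimal.\<close>

lemma (in infinite_grid) S_integrable_decay:
  fixes f :: "nat \<Rightarrow> real \<Rightarrow> real"
  assumes F: "\<And>(T :: (nat \<times> real set \<times> real set \<times> real) filter) ev \<nu>.
      hypergrid N T ev \<eta> \<nu> \<Longrightarrow> F = ev (\<lambda>i. RFun (f (\<nu> i)))"
    and step: "\<And>n x. f n (grid_point n x) = f n x"
    and K: "K \<ge> 0" "\<And>n t. n > 0 \<Longrightarrow> t \<in> {- real n ..< real n} \<Longrightarrow> \<bar>f n t\<bar> \<le> K / (1 + (grid_point n t)\<^sup>2)"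
  shows "S_integrable N \<eta> F"
proof -
  let ?I = "\<lambda>n::nat. {- (int n)\<^sup>2 ..< (int n)\<^sup>2}"
  have pt: "of_int k / real n \<in> {- real n ..< real n}" if "n > 0" "k \<in> ?I n" for k n
    using floor_in_grid[OF that(1), of "of_int k / real n"] that by simp
  have fK: "\<bar>f n (of_int k / real n)\<bar> \<le> K / (1 + (of_int k / real n)\<^sup>2)" if "n > 0" "k \<in> ?I n" for k n
    using K(2)[OF that(1) pt[OF that]] that(1) by simp
  have le_K: "K / (1 + x\<^sup>2) \<le> K" for x :: real
  proof -
    have "K / (1 + x\<^sup>2) \<le> K / 1" using K(1) by (intro divide_left_mono) (auto simp: add_pos_nonneg)
    then show ?thesis by simp
  qed
  obtain T :: "(nat \<times> real set \<times> real set \<times> real) filter" and ev \<nu> \<tau>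
    where h: "hypergrid N T ev \<eta> \<nu>" "emb N (Rl 0) = ev (\<lambda>i. Rl (\<tau> i))"
    by (rule hypergrid_exists_point[OF hyperreal_emb])
  interpret h: hypergrid N T ev \<eta> \<nu> by fact
  have "grid_measurable N \<eta> F"
    unfolding F[OF h(1)] h.grid_measurable_ev using h.eventually_\<nu>[of 0]
    by eventually_elim (intro grid_measurable_step step)
  moreover have "hfinite N (abs_integral_on N \<eta> (Rbar N \<eta>) F)"
    unfolding F[OF h(1)] h.Rbar_ev h.abs_integral_on_ev h.hfinite_ev
  proof (intro exI, use h.eventually_\<nu>[of 0] in eventually_elim)
    case (elim i)
    let ?f = "\<lambda>x. indicator {- real (\<nu> i) ..< real (\<nu> i)} x * \<bar>f (\<nu> i) x\<bar>"
    have "grid_integral (\<nu> i) ?f \<le> grid_integral (\<nu> i) (\<lambda>x. K / (1 + x\<^sup>2))"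
      using fK[OF elim] pt[OF elim] by (intro grid_integral_mono) (simp add: indicator_def)
    moreover have "norm (grid_integral (\<nu> i) (\<lambda>x. K / (1 + x\<^sup>2))) \<le> 3 * K * pi"
      using K(1) by (intro grid_integral_decay) (auto simp: add_nonneg_nonneg)
    moreover have "0 \<le> grid_integral (\<nu> i) ?f" by (intro grid_integral_nonneg) simp
    ultimately show "\<bar>grid_integral (\<nu> i) ?f\<bar> \<le> 3 * K * pi" by simp
  qed
  moreover have "infinitesimal N (abs_integral_on N \<eta> A F)"
    if A: "A \<in> grid_sets N \<eta>" and small: "infinitesimal N (lam N \<eta> A)" for A
  proof -
    obtain T :: "(nat \<times> real set \<times> real set \<times> real) filter" and ev \<nu> a
      where h: "hypergrid N T ev \<eta> \<nu>" "A = ev (\<lambda>i. St (a i))"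
      by (rule hypergrid_exists_set[OF hyperset_grid_sets[OF A]])
    interpret hypergrid N T ev \<eta> \<nu> by fact
    have a: "\<forall>\<^sub>F i in T. a i \<in> grid_algebra (\<nu> i)" using A unfolding h(2) grid_sets_ev .
    have "((\<lambda>i. grid_measure (\<nu> i) (a i)) \<longlongrightarrow> 0) T" using small unfolding h(2) lam_ev infinitesimal_ev .
    then have lim: "((\<lambda>i. K * grid_measure (\<nu> i) (a i)) \<longlongrightarrow> 0) T" by (rule tendsto_mult_right_zero)
    have "\<forall>\<^sub>F i in T. norm (grid_integral (\<nu> i) (\<lambda>x. indicator (a i) x * \<bar>f (\<nu> i) x\<bar>)) \<le> K * grid_measure (\<nu> i) (a i)"
      using a eventually_\<nu>[of 0]
    proof eventually_elim
      case (elim i)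
      have "grid_integral (\<nu> i) (\<lambda>x. indicator (a i) x * \<bar>f (\<nu> i) x\<bar>) \<le> grid_integral (\<nu> i) (\<lambda>x. indicator (a i) x * K)"
        using order_trans[OF fK[OF elim(2)] le_K] by (intro grid_integral_mono mult_left_mono) auto
      moreover have "0 \<le> grid_integral (\<nu> i) (\<lambda>x. indicator (a i) x * \<bar>f (\<nu> i) x\<bar>)"
        by (intro grid_integral_nonneg) simp
      ultimately show ?case using grid_integral_indicator[OF elim(2,1), of K] by simp
    qed
    then show ?thesis unfolding F[OF h(1)] h(2) abs_integral_on_ev infinitesimal_ev
      using lim by (rule Lim_null_comparison)
  qed
  moreover have "infinitesimal N (abs_integral_on N \<eta> A F)"
    if A: "A \<in> grid_sets N \<eta>" and small: "\<forall>x\<in>elems N A. infinitesimal N (rval N F x)" for A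
  proof -
    obtain T :: "(nat \<times> real set \<times> real set \<times> real) filter" and ev \<nu> a
      where h: "hypergrid N T ev \<eta> \<nu>" "A = ev (\<lambda>i. St (a i))"
      by (rule hypergrid_exists_set[OF hyperset_grid_sets[OF A]])
    interpret hypergrid N T ev \<eta> \<nu> by fact
    \<comment> \<open>Pointwise smallness on an internal set is uniform: otherwise violating points
      chosen at each index would form an element of \<open>A\<close> at which \<open>F\<close> is
      not infinitesimal.\<close>
    have unif: "\<forall>\<^sub>F i in T. \<forall>x\<in>a i. \<bar>f (\<nu> i) x\<bar> \<le> c" if c: "c > 0" for c
    proof (rule ccontr)
      assume "\<not> ?thesis"
      then have "\<forall>\<^sub>F i in T. \<not> (\<forall>x\<in>a i. \<bar>f (\<nu> i) x\<bar> \<le> c)" by (rule ultra)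
      then have *: "\<forall>\<^sub>F i in T. (SOME x. x \<in> a i \<and> c < \<bar>f (\<nu> i) x\<bar>) \<in> a i \<and>
          c < \<bar>f (\<nu> i) (SOME x. x \<in> a i \<and> c < \<bar>f (\<nu> i) x\<bar>)\<bar>"
      proof eventually_elim
        case (elim i)
        then have "\<exists>x. x \<in> a i \<and> c < \<bar>f (\<nu> i) x\<bar>" by (auto simp: not_le)
        then show ?case by (rule someI_ex)
      qed
      define \<tau> where "\<tau> i = (SOME x. x \<in> a i \<and> c < \<bar>f (\<nu> i) x\<bar>)" for i
      have "ev (\<lambda>i. Rl (\<tau> i)) \<in> elems N A"
        unfolding h(2) elems_ev \<tau>_def using * by eventually_elim simp
      with small have "((\<lambda>i. f (\<nu> i) (\<tau> i)) \<longlongrightarrow> 0) T"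
        unfolding F[OF h(1)] by (auto simp: rval_ev infinitesimal_ev)
      then have "\<forall>\<^sub>F i in T. dist (f (\<nu> i) (\<tau> i)) 0 < c" using c by (rule tendstoD)
      with * have "\<forall>\<^sub>F i in T. False" unfolding \<tau>_def by eventually_elim simp
      then show False using nontrivial by (simp add: eventually_False)
    qed
    have "((\<lambda>i. grid_integral (\<nu> i) (\<lambda>x. indicator (a i) x * \<bar>f (\<nu> i) x\<bar>)) \<longlongrightarrow> 0) T"
    proof (rule tendstoI)
      fix e :: real assume "e > 0"
      \<comment> \<open>The level \<open>1 / real (Suc j)\<close> is chosen so that the integral of
        the truncated bound is below \<open>e\<close>; the factor \<open>3\<close> allows for
        rounding.\<close>
      from order_tendstoD(2)[OF tendsto_integral_min_decay[of "3 * K"] this] K(1)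
      obtain j where j: "(LINT x|lborel. min (1 / real (Suc j)) (3 * K / (1 + x\<^sup>2))) < e"
        unfolding eventually_sequentially by auto
      have "1 / real (Suc j) > 0" by simp
      from unif[OF this] eventually_\<nu>[of 0]
      show "\<forall>\<^sub>F i in T. dist (grid_integral (\<nu> i) (\<lambda>x. indicator (a i) x * \<bar>f (\<nu> i) x\<bar>)) 0 < e"
      proof eventually_elim
        case (elim i)
        have "grid_integral (\<nu> i) (\<lambda>x. indicator (a i) x * \<bar>f (\<nu> i) x\<bar>) \<le>
            grid_integral (\<nu> i) (\<lambda>x. min (1 / real (Suc j)) (K / (1 + x\<^sup>2)))"
          using fK[OF elim(2)] elim(1) K(1)
          by (intro grid_integral_mono) (auto simp: indicator_def add_nonneg_nonneg)
        also have "\<dots> \<le> (LINT x|lborel. min (1 / real (Suc j)) (3 * K / (1 + x\<^sup>2)))"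
          using elim(2) K(1) by (intro grid_integral_min_decay) auto
        also note j
        finally have "grid_integral (\<nu> i) (\<lambda>x. indicator (a i) x * \<bar>f (\<nu> i) x\<bar>) < e" .
        moreover have "0 \<le> grid_integral (\<nu> i) (\<lambda>x. indicator (a i) x * \<bar>f (\<nu> i) x\<bar>)"
          by (intro grid_integral_nonneg) simp
        ultimately show ?case by simp
      qed
    qed
    then show ?thesis unfolding F[OF h(1)] h(2) abs_integral_on_ev infinitesimal_ev .
  qed
  ultimately show ?thesis unfolding S_integrable_def by blast
qed

theorem theorem24:
  fixes N :: "'h extension" and \<eta> ghat :: 'h and g :: "real \<Rightarrow> complex"
  assumes "nonstandard_extension N" and "countably_saturated N"
    and "schwartz g"
    and "\<eta> \<in> hypernats N - standard_nats N"
    and "ghat = grid_fourier N \<eta> (grid_fun N \<eta> g)"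
  shows "cS_integrable N \<eta> ghat
    \<and> (AE t in loeb N \<eta>. hcfinite N (cval N ghat t) \<and>
           cstd_part N (cval N ghat t) = extend_zero (fourier g) (st N t))
    \<and> integrable (loeb N \<eta>) (\<lambda>t. extend_zero (fourier g) (st N t))
    \<and> integrable lebesgue (fourier g)
    \<and> hcfinite N (cintegral N \<eta> ghat)
    \<and> cstd_part N (cintegral N \<eta> ghat) = (LINT t|loeb N \<eta>. extend_zero (fourier g) (st N t))
    \<and> (LINT t|loeb N \<eta>. extend_zero (fourier g) (st N t)) = (LINT t|lebesgue. fourier g t)"
proof -
  interpret saturated_grid N \<eta> using assms(1,2,4) by unfold_locales
  obtain g1 g2 C where "rapidly_decreasing g g1 g2 C" by (rule schwartz_rapidly_decreasing[OF assms(3)])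
  then interpret rapidly_decreasing g g1 g2 C .
  obtain K where K: "K \<ge> 0" "\<And>n t. n > 0 \<Longrightarrow> t \<in> {- real n ..< real n} \<Longrightarrow>
       norm (grid_transform g n t) \<le> K / (1 + (grid_point n t)\<^sup>2)"
    by (rule grid_transform_decay) blast
  have ghat: "ghat = ev (\<lambda>i. CFun (grid_transform g (\<nu> i)))"
    if "hypergrid N T ev \<eta> \<nu>" for T :: "(nat \<times> real set \<times> real set \<times> real) filter" and ev \<nu>
    unfolding assms(5) by (rule hypergrid.grid_fourier_grid_fun_ev[OF that])
  have "S_integrable N \<eta> (ap N {[CFun f, RFun (\<lambda>x. Re (f x))] |f. True} [ghat])"
  proof (rule S_integrable_decay[OF _ _ K(1)])
    fix T :: "(nat \<times> real set \<times> real set \<times> real) filter" and ev \<nu>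
    assume h: "hypergrid N T ev \<eta> \<nu>"
    then interpret hypergrid N T ev \<eta> \<nu> .
    show "ap N {[CFun f, RFun (\<lambda>x. Re (f x))] |f. True} [ghat] = ev (\<lambda>i. RFun (\<lambda>x. Re (grid_transform g (\<nu> i) x)))"
      unfolding ghat[OF h]
      using ap_ev[of "[\<lambda>i. CFun (grid_transform g (\<nu> i))]" _ "\<lambda>i. RFun (\<lambda>x. Re (grid_transform g (\<nu> i) x))"] by simp
  qed (use K(2) order_trans[OF abs_Re_le_cmod] in auto)
  moreover have "S_integrable N \<eta> (ap N {[CFun f, RFun (\<lambda>x. Im (f x))] |f. True} [ghat])"
  proof (rule S_integrable_decay[OF _ _ K(1)])
    fix T :: "(nat \<times> real set \<times> real set \<times> real) filter" and ev \<nu>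
    assume h: "hypergrid N T ev \<eta> \<nu>"
    then interpret hypergrid N T ev \<eta> \<nu> .
    show "ap N {[CFun f, RFun (\<lambda>x. Im (f x))] |f. True} [ghat] = ev (\<lambda>i. RFun (\<lambda>x. Im (grid_transform g (\<nu> i) x)))"
      unfolding ghat[OF h]
      using ap_ev[of "[\<lambda>i. CFun (grid_transform g (\<nu> i))]" _ "\<lambda>i. RFun (\<lambda>x. Im (grid_transform g (\<nu> i) x))"] by simp
  qed (use K(2) order_trans[OF abs_Im_le_cmod] in auto)
  ultimately have "cS_integrable N \<eta> ghat" unfolding cS_integrable_def ..
  moreover have "AE t in loeb N \<eta>. hcfinite N (cval N ghat t) \<and>
           cstd_part N (cval N ghat t) = extend_zero (fourier g) (st N t)"
  \<comment> \<open>The equality holds at every point of the space, infinite points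
    included.\<close>
  proof (rule AE_I2)
    fix t assume "t \<in> space (loeb N \<eta>)"
    then have t: "t \<in> elems N (Rbar N \<eta>)" by (simp add: loeb_eq_completion)
    obtain T :: "(nat \<times> real set \<times> real set \<times> real) filter" and ev \<nu> \<tau>
      where h: "hypergrid N T ev \<eta> \<nu>" "t = ev (\<lambda>i. Rl (\<tau> i))"
      by (rule hypergrid_exists_point[OF hyperreal_elems[OF t]])
    interpret hypergrid N T ev \<eta> \<nu> by fact
    have val: "cval N ghat t = ev (\<lambda>i. Cx (grid_transform g (\<nu> i) (\<tau> i)))"
      unfolding ghat[OF h(1)] h(2) by (rule cval_ev)
    have "((\<lambda>i. grid_transform g (\<nu> i) (\<tau> i)) \<longlongrightarrow> extend_zero (fourier g) (st N t)) T"
    proof (cases "hfinite N t")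
      case True
      then obtain l where l: "(\<tau> \<longlongrightarrow> l) T" unfolding h(2) hfinite_iff_convergent ..
      have "st N t = ereal l" using True unfolding h(2) st_def std_part_ev[OF l] by simp
      then show ?thesis using tendsto_grid_transform[OF \<nu> l] by (simp add: extend_zero_def)
    next
      case False
      then have "\<not> (\<forall>\<^sub>F i in T. \<bar>\<tau> i\<bar> \<le> r)" for r unfolding h(2) hfinite_ev by blast
      \<comment> \<open>No bound holds on a large set, so the ultrafilter property makes each bound
        fail on one. Working with \<open>\<bar>\<tau> i\<bar>\<close> covers both signs of
        infinity.\<close>
      then have large: "\<forall>\<^sub>F i in T. \<not> \<bar>\<tau> i\<bar> \<le> r" for r by (rule ultra)
      have mem: "\<forall>\<^sub>F i in T. \<tau> i \<in> {- real (\<nu> i) ..< real (\<nu> i)}" using t unfolding h(2) Rbar_ev elems_ev .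
      have "((\<lambda>i. grid_transform g (\<nu> i) (\<tau> i)) \<longlongrightarrow> 0) T"
      proof (rule Lim_null_comparison)
        show "\<forall>\<^sub>F i in T. norm (grid_transform g (\<nu> i) (\<tau> i)) \<le> 3 * K / (1 + (\<tau> i)\<^sup>2)"
          using mem eventually_\<nu>[of 0]
        proof eventually_elim
          case (elim i)
          have "norm (K / (1 + (grid_point (\<nu> i) (\<tau> i))\<^sup>2)) \<le> 3 * K / (1 + (\<tau> i)\<^sup>2)"
            using elim(2) K(1) by (intro decay_grid) (auto simp: add_nonneg_nonneg)
          then show ?case using K(2)[OF elim(2,1)] K(1) by simp
        qed
        have "filterlim (\<lambda>i. \<bar>\<tau> i\<bar>) at_top T"
          unfolding filterlim_at_top
        proof
          show "\<forall>\<^sub>F i in T. Z \<le> \<bar>\<tau> i\<bar>" for Z using large[of Z] by eventually_elim simp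
        qed
        then have "filterlim (\<lambda>i. \<bar>\<tau> i\<bar> ^ 2) at_top T" by (rule filterlim_pow_at_top[rotated]) simp
        then have "filterlim (\<lambda>i. 1 + (\<tau> i)\<^sup>2) at_top T"
          using filterlim_tendsto_add_at_top[OF tendsto_const, of "\<lambda>i. \<bar>\<tau> i\<bar> ^ 2" T 1] by simp
        then show "((\<lambda>i. 3 * K / (1 + (\<tau> i)\<^sup>2)) \<longlongrightarrow> 0) T"
          by (intro tendsto_divide_0[OF tendsto_const] filterlim_at_top_imp_at_infinity)
      qed
      moreover have "extend_zero (fourier g) (st N t) = 0"
        using False by (simp add: st_def extend_zero_def)
      ultimately show ?thesis by simp
    qed
    from complex_std_part[OF this]
    show "hcfinite N (cval N ghat t) \<and> cstd_part N (cval N ghat t) = extend_zero (fourier g) (st N t)"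
      unfolding val by blast
  qed
  moreover have L: "has_bochner_integral (loeb N \<eta>) (\<lambda>t. extend_zero (fourier g) (st N t)) (integral\<^sup>L lborel (fourier g))"
    by (rule has_bochner_integral_loeb[OF integrable_fourier])
  moreover have fm: "fourier g \<in> borel_measurable lborel" by (rule borel_measurable_integrable[OF integrable_fourier])
  have "integrable lebesgue (fourier g)" "integral\<^sup>L lebesgue (fourier g) = integral\<^sup>L lborel (fourier g)"
    using integrable_completion[OF fm] integral_completion[OF fm] integrable_fourier by auto
  moreover have "hcfinite N (cintegral N \<eta> ghat) \<and> cstd_part N (cintegral N \<eta> ghat) = integral\<^sup>L lborel (fourier g)"
  proof -
    \<comment> \<open>The integral depends on \<eta> only, so any germ containing \<eta> will do;
      the embedded \<open>0\<close> is a placeholder for its point.\<close>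
    obtain T :: "(nat \<times> real set \<times> real set \<times> real) filter" and ev \<nu> \<tau>
      where h: "hypergrid N T ev \<eta> \<nu>" "emb N (Rl 0) = ev (\<lambda>i. Rl (\<tau> i))"
      by (rule hypergrid_exists_point[OF hyperreal_emb])
    interpret hypergrid N T ev \<eta> \<nu> by fact
    have "((\<lambda>i. grid_integral (\<nu> i) (grid_transform g (\<nu> i))) \<longlongrightarrow> integral\<^sup>L lborel (fourier g)) T"
      by (rule filterlim_compose[OF tendsto_integral_grid_transform \<nu>])
    from complex_std_part[OF this] show ?thesis unfolding ghat[OF h(1)] cintegral_ev by blast
  qed
  ultimately show ?thesis by (simp add: has_bochner_integral_iff)
qed

end
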